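(* Let $F\subset\mathrm{Sym}^2(\mathbb{R}^n)$ be a cone subequation such that $-P_e\notin F$ for every unit vector $e$. Let $\Omega\subset\mathbb{R}^n$ be a bounded domain, $\varphi\in C(\partial\Omega)$, and $x_1,\dots,x_k\in\Omega$ distinct. For each $j$ let $h_j\in C(\overline\Omega)$ be $F$-harmonic on $\Omega\setminus\{x_j\}$ with a downward-pointing singularity of finite type at $x_j$. Assume: (i) $\partial\Omega$ is smooth and strictly $F$-convex; (ii) each $h_j$ has a strict global minimum on $\overline\Omega$ at $x_j$; (iii) there is $h\in C(\overline\Omega)$ which is $F$-subharmonic on $\Omega\setminus\{x_1,\dots,x_k\}$, with $\lim_{x\to x_j}\frac{h(x)-h(x_j)}{h_j(x)-h_j(x_j)}=1$ for each $j$ and $h|_{\partial\Omega}\le\varphi$. Then there exists $H$ such that: (1) $H\in C(\overline\Omega)$; (2) $H$ is $F$-harmonic on $\Omega\setminus\{x_1,\dots,x_k\}$; (3) $H|_{\partial\Omega}=\varphi$ and $H(x_j)=h(x_j)$ for $j=1,\dots,k$; (4) there is a constant $c>1$ such that for every $\epsilon>0$, $1-\epsilon\le\frac{H(x)-h(x_j)}{h_j(x)-h_j(x_j)}\le c$ for $x$ sufficiently near $x_j$, $j=1,\dots,k$.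
   Context: A cone subequation is a closed $F\subset\mathrm{Sym}^2(\mathbb{R}^n)$ with $A\in F,P\ge0\Rightarrow A+P\in F$ and $tF=F$ for $t>0$; $\tilde F=\{A:-A\notin\mathrm{Int}F\}$; $P_e$ is orthogonal projection onto $\mathbb{R}e$. $F$-subharmonic: upper semicontinuous $[-\infty,\infty)$-valued $u$ with $D^2\phi(y)\in F$ for every $C^2$ test function $\phi$ at $y$ ($u\le\phi$ near $y$, equality at $y$); $F$-harmonic: finite, continuous, $F$-subharmonic with $-u$ $\tilde F$-subharmonic. A downward-pointing singularity of finite type at $x_j$ means: $h_j$ is $F$-subharmonic near $x_j$, $h_j(x)>h_j(x_j)>-\infty$ for $x\neq x_j$ near $x_j$, and $h_j$ has no test functions at $x_j$. Smooth boundary strictly $F$-convex: for each $x\in\partial\Omega$ and local defining function $\rho$, $D^2\rho(x)+tP_\nu\in\mathrm{Int}F$ for all large $t$, $\nu$ the unit normal. *)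

theory Defs
  imports "HOL-Analysis.Analysis"
begin

definition Sym :: "(real^'n^'n) set" where
  "Sym = {A. transpose A = A}"

definition psd :: "real^'n^'n \<Rightarrow> bool" where
  "psd P \<longleftrightarrow> P \<in> Sym \<and> (\<forall>v. v \<bullet> (P *v v) \<ge> 0)"

text \<open>Orthogonal projection onto the line R e (e a unit vector): the matrix e e^T.\<close>
definition projline :: "real^'n \<Rightarrow> real^'n^'n" where
  "projline e = (\<chi> i j. e $ i * e $ j)"

definition cone_subequation :: "(real^'n^'n) set \<Rightarrow> bool" where
  "cone_subequation F \<longleftrightarrow> F \<subseteq> Sym \<and> closed F \<and>
     (\<forall>A\<in>F. \<forall>P. psd P \<longrightarrow> A + P \<in> F) \<and>
     (\<forall>t>0. (\<lambda>A. t *\<^sub>R A) ` F = F)"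

definition IntF :: "(real^'n^'n) set \<Rightarrow> (real^'n^'n) set" where
  "IntF F = (top_of_set Sym) interior_of F"

definition dual_subeq :: "(real^'n^'n) set \<Rightarrow> (real^'n^'n) set" where
  "dual_subeq F = {A \<in> Sym. - A \<notin> IntF F}"

fun Ck :: "nat \<Rightarrow> ('a::euclidean_space) set \<Rightarrow> ('a \<Rightarrow> real) \<Rightarrow> bool" where
  "Ck 0 U f = continuous_on U f"
| "Ck (Suc k) U f = ((\<forall>x\<in>U. f differentiable (at x)) \<and>
      (\<forall>i\<in>Basis. Ck k U (\<lambda>x. frechet_derivative f (at x) i)))"

definition smooth_on :: "('a::euclidean_space) set \<Rightarrow> ('a \<Rightarrow> real) \<Rightarrow> bool" where
  "smooth_on U f \<longleftrightarrow> (\<forall>k. Ck k U f)"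

definition grad :: "(real^'n \<Rightarrow> real) \<Rightarrow> real^'n \<Rightarrow> real^'n" where
  "grad f y = (\<chi> i. frechet_derivative f (at y) (axis i 1))"

definition hessian :: "(real^'n \<Rightarrow> real) \<Rightarrow> real^'n \<Rightarrow> real^'n^'n" where
  "hessian f y = (\<chi> i j. frechet_derivative (\<lambda>z. frechet_derivative f (at z) (axis j 1)) (at y) (axis i 1))"

definition test_function :: "(real^'n \<Rightarrow> real) \<Rightarrow> (real^'n \<Rightarrow> real) \<Rightarrow> real^'n \<Rightarrow> bool" where
  "test_function u \<phi> y \<longleftrightarrow> (\<exists>U. open U \<and> y \<in> U \<and> Ck 2 U \<phi> \<and> (\<forall>x\<in>U. u x \<le> \<phi> x)) \<and> u y = \<phi> y"

definition usc_on :: "(real^'n) set \<Rightarrow> (real^'n \<Rightarrow> real) \<Rightarrow> bool" where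
  "usc_on X u \<longleftrightarrow> (\<forall>x\<in>X. \<forall>e>0. \<exists>d>0. \<forall>y\<in>X. dist y x < d \<longrightarrow> u y < u x + e)"

definition subharmonic :: "(real^'n^'n) set \<Rightarrow> (real^'n) set \<Rightarrow> (real^'n \<Rightarrow> real) \<Rightarrow> bool" where
  "subharmonic F X u \<longleftrightarrow> usc_on X u \<and>
     (\<forall>y\<in>X. \<forall>\<phi>. test_function u \<phi> y \<longrightarrow> hessian \<phi> y \<in> F)"

definition harmonic :: "(real^'n^'n) set \<Rightarrow> (real^'n) set \<Rightarrow> (real^'n \<Rightarrow> real) \<Rightarrow> bool" where
  "harmonic F X u \<longleftrightarrow> continuous_on X u \<and> subharmonic F X u \<and>
     subharmonic (dual_subeq F) X (\<lambda>x. - u x)"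

definition downward_singularity :: "(real^'n^'n) set \<Rightarrow> (real^'n \<Rightarrow> real) \<Rightarrow> real^'n \<Rightarrow> bool" where
  "downward_singularity F h x0 \<longleftrightarrow>
     (\<exists>U. open U \<and> x0 \<in> U \<and> subharmonic F U h) \<and>
     (\<forall>\<^sub>F x in at x0. h x > h x0) \<and>
     \<not> (\<exists>\<phi>. test_function h \<phi> x0)"

definition local_defining_function :: "(real^'n) set \<Rightarrow> real^'n \<Rightarrow> (real^'n \<Rightarrow> real) \<Rightarrow> bool" where
  "local_defining_function \<Omega> x \<rho> \<longleftrightarrow> (\<exists>U. open U \<and> x \<in> U \<and> smooth_on U \<rho> \<and>
     (\<forall>y\<in>U. y \<in> \<Omega> \<longleftrightarrow> \<rho> y < 0) \<and> (\<forall>y\<in>U. grad \<rho> y \<noteq> 0))"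

definition smooth_boundary :: "(real^'n) set \<Rightarrow> bool" where
  "smooth_boundary \<Omega> \<longleftrightarrow> (\<forall>x\<in>frontier \<Omega>. \<exists>\<rho>. local_defining_function \<Omega> x \<rho>)"

definition strictly_F_convex_boundary :: "(real^'n^'n) set \<Rightarrow> (real^'n) set \<Rightarrow> bool" where
  "strictly_F_convex_boundary F \<Omega> \<longleftrightarrow> (\<forall>x\<in>frontier \<Omega>. \<forall>\<rho>. local_defining_function \<Omega> x \<rho> \<longrightarrow>
     (\<exists>T. \<forall>t\<ge>T. hessian \<rho> x + t *\<^sub>R projline ((1 / norm (grad \<rho> x)) *\<^sub>R grad \<rho> x) \<in> IntF F))"

end

theory Submission
  imports Defs
begin

text \<open>
  Near \<open>x\<^sub>j\<close> the solution is squeezed between \<open>h\<close> and an obstacle \<open>w\<close>, the minimum of a constant and of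
  the functions \<open>h(x\<^sub>j) + c (h\<^sub>j - h\<^sub>j(x\<^sub>j))\<close> with \<open>c\<close> large. The solution is the upper envelope \<open>H\<close> of all
  subharmonic functions below \<open>w\<close> with boundary values at most \<open>\<phi>\<close>. No comparison theorem is needed.
  If \<open>\<rho>\<close> defines the boundary near \<open>p\<close>, then \<open>q = \<rho> + s \<rho>\<^sup>2/2 - \<eta>|x - p|\<^sup>2\<close> is a strict \<open>F\<close>-subsolution by
  convexity, while \<open>D\<^sup>2(-q)\<close> avoids \<open>F\<close> because \<open>-P\<^sub>e\<close> does; so \<open>q\<close> gives both barriers, the upper one
  being compared with viscosity subsolutions directly by definition. Hence \<open>H\<close> is controlled near the boundary and the
  singular points, and Walsh's translation argument spreads this to continuity everywhere. If a test
  function touching \<open>H\<close> from below violated the dual condition, it could be pushed up to enlarge \<open>H\<close>,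
  unless \<open>H\<close> touches \<open>w\<close> there; but then it also touches \<open>w\<close>, which is a supersolution.
\<close>

section \<open>Twice continuously differentiable functions\<close>

text \<open>Gradient and Hessian are carried as arguments, so that derivatives of sums, squares and
  translates come from the rules for \<open>has_derivative\<close> instead of iterated
  \<open>frechet_derivative\<close>. Symmetry of \<open>A\<close> is derived below from its
  continuity.\<close>

definition C2_on ::
  "(real^'n) set \<Rightarrow> (real^'n \<Rightarrow> real) \<Rightarrow> (real^'n \<Rightarrow> real^'n) \<Rightarrow> (real^'n \<Rightarrow> real^'n^'n) \<Rightarrow> bool" where
  "C2_on U f G A \<longleftrightarrow> open U \<and> continuous_on U A \<and>
     (\<forall>x\<in>U. (f has_derivative (\<lambda>v. G x \<bullet> v)) (at x) \<and> (G has_derivative (\<lambda>v. A x *v v)) (at x))"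

lemma C2_onD:
  assumes "C2_on U f G A"
  shows "open U" "continuous_on U A"
    "x \<in> U \<Longrightarrow> (f has_derivative (\<lambda>v. G x \<bullet> v)) (at x)"
    "x \<in> U \<Longrightarrow> (G has_derivative (\<lambda>v. A x *v v)) (at x)"
  using assms by (auto simp: C2_on_def)

lemma C2_on_subset: "C2_on U f G A \<Longrightarrow> open V \<Longrightarrow> V \<subseteq> U \<Longrightarrow> C2_on V f G A"
  by (auto simp: C2_on_def intro: continuous_on_subset)

lemma C2_on_continuous: "C2_on U f G A \<Longrightarrow> continuous_on U f"
  by (meson C2_on_def continuous_at_imp_continuous_on has_derivative_continuous)

lemma C2_on_line:
  assumes "C2_on U f G A" "y + s *\<^sub>R a \<in> U"
  shows "((\<lambda>s. f (y + s *\<^sub>R a)) has_real_derivative G (y + s *\<^sub>R a) \<bullet> a) (at s)"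
    and "((\<lambda>s. G (y + s *\<^sub>R a) \<bullet> b) has_real_derivative (A (y + s *\<^sub>R a) *v a) \<bullet> b) (at s)"
proof -
  have l: "((\<lambda>s. y + s *\<^sub>R a) has_derivative (\<lambda>h. h *\<^sub>R a)) (at s)"
    by (auto intro!: derivative_eq_intros)
  have "((\<lambda>s. f (y + s *\<^sub>R a)) has_derivative (\<lambda>h. G (y + s *\<^sub>R a) \<bullet> (h *\<^sub>R a))) (at s)"
    using has_derivative_compose[OF l C2_onD(3)[OF assms]] .
  then show "((\<lambda>s. f (y + s *\<^sub>R a)) has_real_derivative G (y + s *\<^sub>R a) \<bullet> a) (at s)"
    by (rule has_derivative_imp_has_field_derivative) simp
  have "((\<lambda>s. G (y + s *\<^sub>R a)) has_derivative (\<lambda>h. A (y + s *\<^sub>R a) *v (h *\<^sub>R a))) (at s)"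
    using has_derivative_compose[OF l C2_onD(4)[OF assms]] .
  from has_derivative_inner_left[OF this, of b]
  show "((\<lambda>s. G (y + s *\<^sub>R a) \<bullet> b) has_real_derivative (A (y + s *\<^sub>R a) *v a) \<bullet> b) (at s)"
    by (rule has_derivative_imp_has_field_derivative)
       (simp add: matrix_vector_mult_scaleR)
qed

text \<open>Two applications of the mean value theorem: first in direction \<open>a\<close> to the
  increment of \<open>f\<close> by \<open>t *\<^sub>R b\<close>, then in direction \<open>b\<close>
  to the resulting gradient component.\<close>

lemma C2_on_second_difference:
  assumes "C2_on U f G A" "ball y R \<subseteq> U" "0 < t" "t * (norm a + norm b) < R"
  shows "\<exists>\<xi>\<in>ball y R. f (y + t *\<^sub>R a + t *\<^sub>R b) - f (y + t *\<^sub>R a) - f (y + t *\<^sub>R b) + f y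
            = t\<^sup>2 * ((A \<xi> *v b) \<bullet> a)"
proof -
  have inU: "y + s *\<^sub>R a + r *\<^sub>R b \<in> ball y R" if "0 \<le> s" "s \<le> t" "0 \<le> r" "r \<le> t" for s r
  proof -
    have "norm (s *\<^sub>R a + r *\<^sub>R b) \<le> s * norm a + r * norm b"
      using that by (metis norm_triangle_le norm_scaleR abs_of_nonneg order_refl add_mono)
    also have "\<dots> \<le> t * norm a + t * norm b"
      using that by (intro add_mono mult_right_mono) auto
    finally have "norm (s *\<^sub>R a + r *\<^sub>R b) < R"
      using assms(4) by (simp add: distrib_left)
    then show ?thesis
      by (simp add: dist_norm norm_minus_commute add.assoc add.commute)
  qed
  let ?g = "\<lambda>s. f ((y + t *\<^sub>R b) + s *\<^sub>R a) - f (y + s *\<^sub>R a)"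
  have "\<exists>s>0. s < t \<and> ?g t - ?g 0 =
      (t - 0) * (G ((y + t *\<^sub>R b) + s *\<^sub>R a) \<bullet> a - G (y + s *\<^sub>R a) \<bullet> a)"
  proof (rule MVT2[OF \<open>0 < t\<close>])
    fix s :: real assume s: "0 \<le> s" "s \<le> t"
    have "(y + t *\<^sub>R b) + s *\<^sub>R a \<in> U" "y + s *\<^sub>R a \<in> U"
      using inU[of s t] inU[of s 0] s assms(2,3) by (auto simp: algebra_simps)
    then show "(?g has_real_derivative
        G ((y + t *\<^sub>R b) + s *\<^sub>R a) \<bullet> a - G (y + s *\<^sub>R a) \<bullet> a) (at s)"
      by (intro DERIV_diff C2_on_line(1)[OF assms(1)])
  qed
  then obtain s where s: "0 < s" "s < t" and
    1: "?g t - ?g 0 = t * (G ((y + t *\<^sub>R b) + s *\<^sub>R a) \<bullet> a - G (y + s *\<^sub>R a) \<bullet> a)" by auto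
  let ?k = "\<lambda>r. G ((y + s *\<^sub>R a) + r *\<^sub>R b) \<bullet> a"
  have "\<exists>r>0. r < t \<and> ?k t - ?k 0 = (t - 0) * ((A ((y + s *\<^sub>R a) + r *\<^sub>R b) *v b) \<bullet> a)"
    using inU s assms(2) by (intro MVT2[OF \<open>0 < t\<close>] C2_on_line(2)[OF assms(1)]) auto
  then obtain r where r: "0 < r" "r < t"
    and 2: "?k t - ?k 0 = t * ((A ((y + s *\<^sub>R a) + r *\<^sub>R b) *v b) \<bullet> a)" by auto
  have "?g t - ?g 0 = t * (?k t - ?k 0)"
    using 1 by (simp add: algebra_simps)
  then have "?g t - ?g 0 = t\<^sup>2 * ((A ((y + s *\<^sub>R a) + r *\<^sub>R b) *v b) \<bullet> a)"
    using 2 by (simp add: power2_eq_square)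
  then show ?thesis
    using inU[of s r] r s by (intro bexI[of _ "y + s *\<^sub>R a + r *\<^sub>R b"]) (auto simp: algebra_simps)
qed

text \<open>Schwarz's theorem: the second difference is symmetric in \<open>a\<close> and
  \<open>b\<close>, so the two orders of taking mean values give equal numbers at two points near
  \<open>y\<close>; continuity of \<open>A\<close> moves both points to \<open>y\<close>.\<close>

lemma C2_on_inner_commute:
  assumes C: "C2_on U f G A" and y: "y \<in> U"
  shows "(A y *v b) \<bullet> a = (A y *v a) \<bullet> b"
proof (rule ccontr)
  \<comment> \<open>Half the supposed discrepancy: two errors, each below \<open>e\<close>, cannot
    add up to it.\<close>
  define e where "e = \<bar>(A y *v b) \<bullet> a - (A y *v a) \<bullet> b\<bar> / 2"
  assume "\<not> ?thesis"
  then have e: "e > 0" by (simp add: e_def)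
  have cont: "continuous (at y) (\<lambda>x. (A x *v c) \<bullet> d)" for c d
  proof -
    have "continuous (at y) A"
      using continuous_on_eq_continuous_at[OF C2_onD(1)[OF C]] C2_onD(2)[OF C] y by blast
    then show ?thesis
      unfolding matrix_vector_mult_def inner_vec_def
      by (auto intro!: continuous_intros)
  qed
  obtain d1 where d1: "d1 > 0" "\<And>x. dist x y < d1 \<Longrightarrow> \<bar>(A x *v b) \<bullet> a - (A y *v b) \<bullet> a\<bar> < e"
    using cont[of b a] e unfolding continuous_at_eps_delta dist_real_def by blast
  obtain d2 where d2: "d2 > 0" "\<And>x. dist x y < d2 \<Longrightarrow> \<bar>(A x *v a) \<bullet> b - (A y *v a) \<bullet> b\<bar> < e"
    using cont[of a b] e unfolding continuous_at_eps_delta dist_real_def by blast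
  obtain d3 where d3: "d3 > 0" "ball y d3 \<subseteq> U"
    using C y by (meson C2_onD(1) open_contains_ball)
  define R where "R = min d1 (min d2 d3)"
  define t where "t = R / (2 * (norm a + norm b + 1))"
  have R: "R > 0" "ball y R \<subseteq> U" using d1 d2 d3 by (auto simp: R_def)
  have pos: "norm a + norm b + 1 > 0" by (smt (verit) norm_ge_zero)
  then have t: "t > 0" using R by (simp add: t_def)
  have "t * (norm a + norm b) \<le> t * (norm a + norm b + 1)" using t by simp
  also have "\<dots> = R / 2" using pos unfolding t_def by (simp add: field_simps)
  finally have tR: "t * (norm a + norm b) < R" using R by simp
  obtain \<xi> where \<xi>: "\<xi> \<in> ball y R"
    and 1: "f (y + t *\<^sub>R a + t *\<^sub>R b) - f (y + t *\<^sub>R a) - f (y + t *\<^sub>R b) + f y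
            = t\<^sup>2 * ((A \<xi> *v b) \<bullet> a)"
    using C2_on_second_difference[OF C R(2) t tR] by blast
  obtain \<xi>' where \<xi>': "\<xi>' \<in> ball y R"
    and 2: "f (y + t *\<^sub>R b + t *\<^sub>R a) - f (y + t *\<^sub>R b) - f (y + t *\<^sub>R a) + f y
            = t\<^sup>2 * ((A \<xi>' *v a) \<bullet> b)"
    using C2_on_second_difference[OF C R(2) t, of b a] tR by (auto simp: add.commute)
  have "t\<^sup>2 * ((A \<xi> *v b) \<bullet> a) = t\<^sup>2 * ((A \<xi>' *v a) \<bullet> b)"
    using 1 2 by (simp add: algebra_simps)
  then have eq: "(A \<xi> *v b) \<bullet> a = (A \<xi>' *v a) \<bullet> b" using t by simp
  have "\<bar>(A \<xi> *v b) \<bullet> a - (A y *v b) \<bullet> a\<bar> < e" "\<bar>(A \<xi>' *v a) \<bullet> b - (A y *v a) \<bullet> b\<bar> < e"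
    using \<xi> \<xi>' d1 d2 by (auto simp: R_def dist_commute)
  then have "\<bar>(A y *v b) \<bullet> a - (A y *v a) \<bullet> b\<bar> < 2 * e" using eq by linarith
  then show False by (simp add: e_def)
qed

lemma mat_axis_component: "(A *v axis j (1::real)) $ i = A $ i $ j"
  by (simp add: matrix_vector_mult_basis column_def)

lemma C2_on_Sym:
  assumes "C2_on U f G A" "y \<in> U"
  shows "A y \<in> Sym"
proof -
  have "A y $ i $ j = A y $ j $ i" for i j
    using C2_on_inner_commute[OF assms, of "axis j 1" "axis i 1"]
    by (simp add: inner_axis mat_axis_component)
  then show ?thesis by (simp add: Sym_def transpose_def vec_eq_iff)
qed

text \<open>If \<open>v\<close> were a negative direction, the derivative of \<open>f\<close> along
  the line through \<open>y\<close> would vanish at \<open>y\<close> and be negative just after it,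
  and the mean value theorem would push \<open>f\<close> below \<open>f y\<close>.\<close>

lemma C2_on_local_min_psd:
  fixes A :: "real^'n \<Rightarrow> real^'n^'n"
  assumes C: "C2_on U f G A" and y: "y \<in> U" and min: "\<And>x. x \<in> U \<Longrightarrow> f y \<le> f x"
  shows "psd (A y)"
  unfolding psd_def
proof (intro conjI allI)
  show "A y \<in> Sym" using C2_on_Sym[OF C y] .
  fix v :: "real^'n"
  obtain R where R: "R > 0" "ball y R \<subseteq> U" using C y by (meson C2_onD(1) open_contains_ball)
  define d where "d = R / (norm v + 1)"
  have pos: "norm v + 1 > 0" by (smt (verit) norm_ge_zero)
  have d: "d > 0" using R pos by (simp add: d_def)
  have inU: "y + s *\<^sub>R v \<in> U" if "\<bar>s\<bar> < d" for s
  proof -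
    have "\<bar>s\<bar> * norm v \<le> \<bar>s\<bar> * (norm v + 1)" by (simp add: distrib_left)
    also have "\<dots> < d * (norm v + 1)" using that pos by simp
    finally show ?thesis using R pos by (auto simp: d_def dist_norm subset_iff)
  qed
  show "0 \<le> v \<bullet> (A y *v v)"
  proof (rule ccontr)
    assume "\<not> ?thesis"
    then have neg: "(A y *v v) \<bullet> v < 0" by (simp add: inner_commute)
    let ?g = "\<lambda>s. G (y + s *\<^sub>R v) \<bullet> v"
    have der: "((\<lambda>s. f (y + s *\<^sub>R v)) has_real_derivative ?g s) (at s)" if "\<bar>s\<bar> < d" for s
      using C2_on_line(1)[OF C inU[OF that]] .
    have g0: "?g 0 = 0"
      using DERIV_local_min[OF der[of 0] d] d min[OF inU] by auto
    have "(?g has_real_derivative (A (y + 0 *\<^sub>R v) *v v) \<bullet> v) (at 0)"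
      by (rule C2_on_line(2)[OF C]) (use y in simp)
    from DERIV_neg_dec_right[OF this] neg
    obtain d' where d': "d' > 0" "\<And>s. 0 < s \<Longrightarrow> s < d' \<Longrightarrow> ?g s < ?g 0"
      by auto
    define t where "t = min d d' / 2"
    have t: "0 < t" "t < d" "t < d'" using d d' by (auto simp: t_def)
    obtain s where s: "0 < s" "s < t" "f (y + t *\<^sub>R v) - f (y + 0 *\<^sub>R v) = (t - 0) * ?g s"
    proof -
      have "\<exists>s>0. s < t \<and> f (y + t *\<^sub>R v) - f (y + 0 *\<^sub>R v) = (t - 0) * ?g s"
        using t by (intro MVT2 der) auto
      then show ?thesis using that by blast
    qed
    have "t * ?g s < 0" using d'(2)[of s] s t g0 by (simp add: mult_pos_neg)
    then have "f (y + t *\<^sub>R v) < f y" using s by simp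
    then show False using min[OF inU, of t] t by simp
  qed
qed

section \<open>Agreement of \<open>C2_on\<close> with \<open>Ck\<close> and
  \<open>hessian\<close>\<close>

lemma frechet_derivative_eq:
  "(f has_derivative f') (at x) \<Longrightarrow> frechet_derivative f (at x) = f'"
  by (metis frechet_derivative_at)

lemma C2_on_partial:
  assumes C: "C2_on U f G A" and x: "x \<in> U"
  shows "((\<lambda>z. frechet_derivative f (at z) b) has_derivative (\<lambda>v. (A x *v v) \<bullet> b)) (at x)"
proof -
  have "((\<lambda>z. G z \<bullet> b) has_derivative (\<lambda>v. (A x *v v) \<bullet> b)) (at x)"
    by (intro has_derivative_inner_left C2_onD(4)[OF C x])
  then show ?thesis
    by (rule has_derivative_transform_within_open[OF _ C2_onD(1)[OF C] x])
       (simp add: frechet_derivative_eq[OF C2_onD(3)[OF C]])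
qed

lemma C2_on_imp_Ck2:
  assumes C: "C2_on U f G A"
  shows "Ck 2 U f"
proof -
  have "continuous_on U (\<lambda>x. frechet_derivative (\<lambda>z. frechet_derivative f (at z) b) (at x) c)" for b c
  proof (rule continuous_on_eq)
    show "continuous_on U (\<lambda>x. (A x *v c) \<bullet> b)"
      unfolding matrix_vector_mult_def inner_vec_def
      using C by (auto intro!: continuous_intros simp: C2_on_def)
  qed (simp add: frechet_derivative_eq[OF C2_on_partial[OF C]])
  then show ?thesis
    by (auto simp: numeral_2_eq_2 intro: differentiableI C2_onD(3)[OF C] C2_on_partial[OF C])
qed

text \<open>\<open>hessian\<close> indexes the partial derivatives in the order opposite to the
  Jacobian of the gradient; symmetry of \<open>A x\<close> removes the transpose.\<close>

lemma C2_on_hessian: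
  assumes C: "C2_on U f G A" and x: "x \<in> U"
  shows "hessian f x = A x"
proof -
  have "hessian f x = transpose (A x)"
    by (simp add: hessian_def frechet_derivative_eq[OF C2_on_partial[OF C x]] vec_eq_iff
        inner_axis mat_axis_component transpose_def)
  then show ?thesis using C2_on_Sym[OF C x] by (simp add: Sym_def)
qed

lemma linear_inner_axis_sum:
  assumes "linear D"
  shows "D (v::real^'n) = (\<chi> i. D (axis i 1)) \<bullet> v"
proof -
  have "D v = D (\<Sum>i\<in>UNIV. v $ i *\<^sub>R axis i 1)"
    using basis_expansion[of v] by (simp add: scalar_mult_eq_scaleR)
  also have "\<dots> = (\<chi> i. D (axis i 1)) \<bullet> v"
    using assms by (simp add: linear_sum linear_cmul inner_vec_def mult.commute)
  finally show ?thesis .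
qed

lemma Ck2_imp_C2_on:
  assumes "open U" and Ck: "Ck 2 U (f :: real^'n \<Rightarrow> real)"
  shows "C2_on U f (grad f) (hessian f)"
proof -
  let ?p = "\<lambda>i z. frechet_derivative f (at z) (axis i 1)"
  have d1: "\<And>x. x \<in> U \<Longrightarrow> f differentiable (at x)"
    and d2: "\<And>x i. x \<in> U \<Longrightarrow> ?p i differentiable (at x)"
    and c2: "\<And>i j. continuous_on U (\<lambda>x. frechet_derivative (?p j) (at x) (axis i 1))"
    using Ck by (auto simp: numeral_2_eq_2)
  \<comment> \<open>Row \<open>j\<close> is the derivative of the \<open>j\<close>-th gradient
    component, so this is the Jacobian of \<open>grad f\<close>; once \<open>C2_on\<close> is known
    for it, it can be identified with \<open>hessian f\<close>.\<close>
  define A where "A x = (\<chi> j i. frechet_derivative (?p j) (at x) (axis i 1))" for x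
  have "C2_on U f (grad f) A"
    unfolding C2_on_def
  proof (intro conjI ballI)
    show "open U" by fact
    show "continuous_on U A"
      unfolding A_def by (intro continuous_on_vec_lambda c2)
    fix x assume x: "x \<in> U"
    have D: "(f has_derivative frechet_derivative f (at x)) (at x)"
      using d1[OF x] frechet_derivative_works by blast
    show "(f has_derivative (\<lambda>v. grad f x \<bullet> v)) (at x)"
      using D linear_inner_axis_sum[OF has_derivative_linear[OF D]]
      by (metis (no_types, lifting) ext grad_def)
    have "((\<lambda>z. grad f z $ j) has_derivative (\<lambda>v. (A x *v v) $ j)) (at x)" for j
    proof -
      have D: "(?p j has_derivative frechet_derivative (?p j) (at x)) (at x)"
        using d2[OF x] frechet_derivative_works by blast
      have "(A x *v v) $ j = frechet_derivative (?p j) (at x) v" for v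
        by (subst linear_inner_axis_sum[OF has_derivative_linear[OF D]])
           (simp add: A_def matrix_vector_mult_def inner_vec_def)
      then show ?thesis using D by (simp add: grad_def)
    qed
    then show "(grad f has_derivative (\<lambda>v. A x *v v)) (at x)"
      by (subst has_derivative_componentwise_within)
         (auto simp: Basis_vec_def inner_axis)
  qed
  moreover from this have "\<And>x. x \<in> U \<Longrightarrow> A x = hessian f x" using C2_on_hessian by metis
  ultimately show ?thesis by (auto simp: C2_on_def cong: continuous_on_cong)
qed

section \<open>Operations that preserve \<open>C2_on\<close>\<close>

lemma C2_on_cong_derivs:
  assumes "C2_on U f G A" "\<And>x. x \<in> U \<Longrightarrow> A x = A' x" "\<And>x. G x = G' x" "\<And>x. f x = f' x"
  shows "C2_on U f' G' A'"
proof -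
  have "G = G'" "f = f'" using assms by auto
  with assms show ?thesis by (auto simp: C2_on_def cong: continuous_on_cong)
qed

lemma C2_on_lincomb:
  assumes "C2_on U f G A" "C2_on U g H B"
  shows "C2_on U (\<lambda>x. a * f x + b * g x + c) (\<lambda>x. a *\<^sub>R G x + b *\<^sub>R H x) (\<lambda>x. a *\<^sub>R A x + b *\<^sub>R B x)"
  unfolding C2_on_def
proof (intro conjI ballI)
  show "open U" using assms C2_onD by blast
  show "continuous_on U (\<lambda>x. a *\<^sub>R A x + b *\<^sub>R B x)"
    by (intro continuous_intros C2_onD[OF assms(1)] C2_onD[OF assms(2)])
  fix x assume x: "x \<in> U"
  note D = C2_onD(3,4)[OF assms(1) x] C2_onD(3,4)[OF assms(2) x]
  show "((\<lambda>x. a * f x + b * g x + c) has_derivative (\<lambda>v. (a *\<^sub>R G x + b *\<^sub>R H x) \<bullet> v)) (at x)"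
    by (auto intro!: derivative_eq_intros D simp: inner_simps algebra_simps)
  show "((\<lambda>x. a *\<^sub>R G x + b *\<^sub>R H x) has_derivative (\<lambda>v. (a *\<^sub>R A x + b *\<^sub>R B x) *v v)) (at x)"
    by (auto intro!: derivative_eq_intros D
        simp: matrix_vector_mult_add_rdistrib scaleR_matrix_vector_assoc)
qed

lemma C2_on_affine:
  assumes "C2_on U f G A"
  shows "C2_on U (\<lambda>x. a * f x + c) (\<lambda>x. a *\<^sub>R G x) (\<lambda>x. a *\<^sub>R A x)"
  by (rule C2_on_cong_derivs[OF C2_on_lincomb[OF assms assms, of a 0 c]]) auto

lemma C2_on_sqdist:
  assumes "open U"
  shows "C2_on U (\<lambda>x. (norm (x - p))\<^sup>2) (\<lambda>x. 2 *\<^sub>R (x - p)) (\<lambda>x. 2 *\<^sub>R mat 1)"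
  unfolding C2_on_def
  by (auto intro!: derivative_eq_intros assms
      simp: power2_norm_eq_inner inner_commute scaleR_matrix_vector_assoc[symmetric])

text \<open>The standard perturbation: it shifts the Hessian by a small multiple of the identity,
  and makes a touching strict or a barrier decay away from \<open>p\<close>.\<close>

lemma C2_on_add_sqdist:
  assumes "C2_on U f G A"
  shows "C2_on U (\<lambda>x. f x + b * (norm (x - p))\<^sup>2 + c) (\<lambda>x. G x + (2 * b) *\<^sub>R (x - p))
           (\<lambda>x. A x + (2 * b) *\<^sub>R mat 1)"
  by (rule C2_on_cong_derivs[OF C2_on_lincomb[OF assms C2_on_sqdist[of U p], of 1 b c]])
     (auto simp: C2_onD[OF assms])

lemma C2_on_diff:
  assumes "C2_on U f G A" "C2_on U g H B"
  shows "C2_on U (\<lambda>x. f x - g x) (\<lambda>x. G x - H x) (\<lambda>x. A x - B x)"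
  by (rule C2_on_cong_derivs[OF C2_on_lincomb[OF assms, of 1 "-1" 0]]) auto

lemma C2_on_translate:
  assumes "C2_on U f G A"
  shows "C2_on ((+) (- y) ` U) (\<lambda>x. f (x + y)) (\<lambda>x. G (x + y)) (\<lambda>x. A (x + y))"
  unfolding C2_on_def
proof (intro conjI ballI)
  show "open ((+) (- y) ` U)" using C2_onD(1)[OF assms] by (rule open_translation)
  show "continuous_on ((+) (- y) ` U) (\<lambda>x. A (x + y))"
    by (rule continuous_on_compose2[OF C2_onD(2)[OF assms]]) (auto intro!: continuous_intros)
  fix x assume "x \<in> (+) (- y) ` U"
  then have x: "x + y \<in> U" by auto
  have l: "((\<lambda>x. x + y) has_derivative (\<lambda>v. v)) (at x)" by (auto intro!: derivative_eq_intros)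
  show "((\<lambda>x. f (x + y)) has_derivative (\<lambda>v. G (x + y) \<bullet> v)) (at x)"
    using has_derivative_compose[OF l C2_onD(3)[OF assms x]] .
  show "((\<lambda>x. G (x + y)) has_derivative (\<lambda>v. A (x + y) *v v)) (at x)"
    using has_derivative_compose[OF l C2_onD(4)[OF assms x]] .
qed

lemma projline_mult: "projline g *v v = (g \<bullet> v) *\<^sub>R g"
  by (simp add: projline_def matrix_vector_mult_def inner_vec_def vec_eq_iff sum_distrib_left
      sum_distrib_right ac_simps)

text \<open>Where \<open>f\<close> vanishes the Hessian gains exactly
  \<open>s *\<^sub>R projline (G x)\<close>. This realizes the normal term that appears in strict
  convexity of the boundary.\<close>

lemma C2_on_add_square:
  assumes C: "C2_on U f G A"
  shows "C2_on U (\<lambda>x. f x + (s / 2) * (f x)\<^sup>2) (\<lambda>x. (1 + s * f x) *\<^sub>R G x)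
           (\<lambda>x. (1 + s * f x) *\<^sub>R A x + s *\<^sub>R projline (G x))"
  unfolding C2_on_def
proof (intro conjI ballI)
  show "open U" using C C2_onD by blast
  have G: "continuous_on U G"
    using C by (meson C2_on_def continuous_at_imp_continuous_on has_derivative_continuous)
  then show "continuous_on U (\<lambda>x. (1 + s * f x) *\<^sub>R A x + s *\<^sub>R projline (G x))"
    unfolding projline_def
    by (intro continuous_intros C2_on_continuous[OF C] C2_onD[OF C])
  fix x assume x: "x \<in> U"
  note D = C2_onD(3,4)[OF C x]
  show "((\<lambda>x. f x + (s / 2) * (f x)\<^sup>2) has_derivative (\<lambda>v. ((1 + s * f x) *\<^sub>R G x) \<bullet> v)) (at x)"
    by (auto intro!: derivative_eq_intros D simp: inner_simps algebra_simps)
  show "((\<lambda>x. (1 + s * f x) *\<^sub>R G x) has_derivative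
     (\<lambda>v. ((1 + s * f x) *\<^sub>R A x + s *\<^sub>R projline (G x)) *v v)) (at x)"
    by (auto intro!: derivative_eq_intros D
        simp: matrix_vector_mult_add_rdistrib scaleR_matrix_vector_assoc[symmetric] projline_mult algebra_simps)
qed

section \<open>Subharmonic functions\<close>

text \<open>The factor 2 matches the Hessian of \<open>\<eta> * (norm (x - p))\<^sup>2\<close>; the
  lemma makes that perturbation as small as required.\<close>

lemma small_multiple:
  fixes M :: "'a::real_normed_vector"
  assumes "\<delta> > 0"
  obtains \<eta> where "\<eta> > 0" "norm ((2 * \<eta>) *\<^sub>R M) \<le> \<delta>"
proof
  have pos: "norm M + 1 > 0" by (smt (verit) norm_ge_zero)
  then show eta: "\<delta> / (2 * (norm M + 1)) > 0" using assms by simp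
  have "2 * (\<delta> / (2 * (norm M + 1))) = \<delta> / (norm M + 1)" by (simp del: distrib_left_numeral)
  then have "norm ((2 * (\<delta> / (2 * (norm M + 1)))) *\<^sub>R M) = \<delta> * (norm M / (norm M + 1))"
    using pos assms by simp
  also have "\<dots> \<le> \<delta> * 1"
    using pos assms by (intro mult_left_mono) auto
  finally show "norm ((2 * (\<delta> / (2 * (norm M + 1)))) *\<^sub>R M) \<le> \<delta>" by simp
qed

lemma subharmonicD:
  assumes "subharmonic F X u" "y \<in> X" "C2_on U \<phi> G A" "y \<in> U"
    "\<And>x. x \<in> U \<Longrightarrow> u x \<le> \<phi> x" "u y = \<phi> y"
  shows "A y \<in> F"
proof -
  have "test_function u \<phi> y"
    unfolding test_function_def
    using assms(4-6) C2_onD(1)[OF assms(3)] C2_on_imp_Ck2[OF assms(3)] by (intro conjI exI[of _ U]) auto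
  then have "hessian \<phi> y \<in> F" using assms(1,2) unfolding subharmonic_def by blast
  then show ?thesis by (simp add: C2_on_hessian[OF assms(3,4)])
qed

text \<open>A test neighbourhood may be intersected with the open set \<open>X\<close>, so only test
  functions living inside \<open>X\<close> have to be checked.\<close>

lemma subharmonicI:
  assumes "open X" "usc_on X u"
    and "\<And>y U \<phi> G A. \<lbrakk>y \<in> U; U \<subseteq> X; C2_on U \<phi> G A;
           \<And>x. x \<in> U \<Longrightarrow> u x \<le> \<phi> x; u y = \<phi> y\<rbrakk> \<Longrightarrow> A y \<in> F"
  shows "subharmonic F X u"
  unfolding subharmonic_def
proof (intro conjI ballI allI impI)
  fix y \<phi> assume y: "y \<in> X" and "test_function u \<phi> y"
  then obtain U where U: "open U" "y \<in> U" "Ck 2 U \<phi>" "\<forall>x\<in>U. u x \<le> \<phi> x" "u y = \<phi> y"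
    unfolding test_function_def by blast
  have "C2_on (U \<inter> X) \<phi> (grad \<phi>) (hessian \<phi>)"
    by (rule C2_on_subset[OF Ck2_imp_C2_on[OF U(1,3)]]) (use U(1) \<open>open X\<close> in auto)
  then show "hessian \<phi> y \<in> F" using assms(3)[of y "U \<inter> X"] U y by auto
qed fact

section \<open>Upper semicontinuous functions\<close>

lemma usc_onD:
  assumes "usc_on X u" "x \<in> X" "e > 0"
  obtains d where "d > 0" "\<And>y. y \<in> X \<Longrightarrow> dist y x < d \<Longrightarrow> u y < u x + e"
  using assms unfolding usc_on_def by blast

lemma usc_on_subset: "usc_on X u \<Longrightarrow> Y \<subseteq> X \<Longrightarrow> usc_on Y u"
  unfolding usc_on_def by blast

lemma subharmonic_usc: "subharmonic F X u \<Longrightarrow> usc_on X u"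
  by (simp add: subharmonic_def)

lemma subharmonic_subset: "subharmonic F X u \<Longrightarrow> Y \<subseteq> X \<Longrightarrow> subharmonic F Y u"
  unfolding subharmonic_def using usc_on_subset by (meson subsetD)

lemma continuous_imp_usc_on:
  assumes "continuous_on X u"
  shows "usc_on X u"
  unfolding usc_on_def
proof (intro ballI allI impI)
  fix x and e :: real assume "x \<in> X" "e > 0"
  then obtain d where "d > 0" "\<And>y. y \<in> X \<Longrightarrow> dist y x < d \<Longrightarrow> dist (u y) (u x) < e"
    using assms unfolding continuous_on_iff by blast
  then show "\<exists>d>0. \<forall>y\<in>X. dist y x < d \<longrightarrow> u y < u x + e"
    by (intro exI[of _ d]) (force simp: dist_real_def)
qed

lemma usc_on_add:
  assumes "usc_on X u" "usc_on X v"
  shows "usc_on X (\<lambda>x. u x + v x)"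
  unfolding usc_on_def
proof (intro ballI allI impI)
  fix x and e :: real assume x: "x \<in> X" "e > 0"
  obtain d1 where d1: "d1 > 0" "\<And>y. y \<in> X \<Longrightarrow> dist y x < d1 \<Longrightarrow> u y < u x + e / 2"
    using usc_onD[OF assms(1), of x "e/2"] x by auto
  obtain d2 where d2: "d2 > 0" "\<And>y. y \<in> X \<Longrightarrow> dist y x < d2 \<Longrightarrow> v y < v x + e / 2"
    using usc_onD[OF assms(2), of x "e/2"] x by auto
  show "\<exists>d>0. \<forall>y\<in>X. dist y x < d \<longrightarrow> u y + v y < u x + v x + e"
  proof (intro exI[of _ "min d1 d2"] conjI ballI impI)
    fix y assume "y \<in> X" "dist y x < min d1 d2"
    then show "u y + v y < u x + v x + e" using d1(2)[of y] d2(2)[of y] by simp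
  qed (use d1 d2 in simp)
qed

lemma usc_on_diff_continuous:
  assumes "usc_on X u" "continuous_on X v"
  shows "usc_on X (\<lambda>x. u x - v x)"
  using usc_on_add[OF assms(1) continuous_imp_usc_on[OF continuous_on_minus[OF assms(2)]]] by simp

lemma usc_on_max:
  assumes "usc_on X u" "usc_on X v"
  shows "usc_on X (\<lambda>x. max (u x) (v x))"
  unfolding usc_on_def
proof (intro ballI allI impI)
  fix x and e :: real assume x: "x \<in> X" "e > 0"
  obtain d1 where d1: "d1 > 0" "\<And>y. y \<in> X \<Longrightarrow> dist y x < d1 \<Longrightarrow> u y < u x + e"
    using usc_onD[OF assms(1) x] by auto
  obtain d2 where d2: "d2 > 0" "\<And>y. y \<in> X \<Longrightarrow> dist y x < d2 \<Longrightarrow> v y < v x + e"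
    using usc_onD[OF assms(2) x] by auto
  show "\<exists>d>0. \<forall>y\<in>X. dist y x < d \<longrightarrow> max (u y) (v y) < max (u x) (v x) + e"
  proof (intro exI[of _ "min d1 d2"] conjI ballI impI)
    fix y assume "y \<in> X" "dist y x < min d1 d2"
    then show "max (u y) (v y) < max (u x) (v x) + e" using d1(2)[of y] d2(2)[of y] by auto
  qed (use d1 d2 in simp)
qed

text \<open>Without a maximum every \<open>z\<close> has a point \<open>b z\<close> of larger value,
  and by upper semicontinuity \<open>u\<close> stays below \<open>u (b z)\<close> near
  \<open>z\<close>. In a finite subcover the largest of the values \<open>u (b z)\<close> would
  itself be exceeded.\<close>

lemma usc_attains_max:
  assumes "compact K" "K \<noteq> {}" "usc_on K u"
  obtains z where "z \<in> K" "\<And>x. x \<in> K \<Longrightarrow> u x \<le> u z"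
proof (rule ccontr)
  assume "\<not> thesis"
  with that have "\<forall>z\<in>K. \<exists>y. y \<in> K \<and> u z < u y" by (meson not_le)
  from bchoice[OF this] obtain b where b: "\<And>z. z \<in> K \<Longrightarrow> b z \<in> K" "\<And>z. z \<in> K \<Longrightarrow> u z < u (b z)"
    by blast
  have "\<forall>z\<in>K. \<exists>d>0. \<forall>y\<in>K. dist y z < d \<longrightarrow> u y < u (b z)"
  proof
    fix z assume z: "z \<in> K"
    then have "u (b z) - u z > 0" using b(2) by simp
    from usc_onD[OF assms(3) z this] obtain d
      where "d > 0" "\<And>y. y \<in> K \<Longrightarrow> dist y z < d \<Longrightarrow> u y < u z + (u (b z) - u z)" by blast
    then show "\<exists>d>0. \<forall>y\<in>K. dist y z < d \<longrightarrow> u y < u (b z)" by (intro exI[of _ d]) simp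
  qed
  from bchoice[OF this] obtain d
    where d: "\<And>z. z \<in> K \<Longrightarrow> d z > 0" "\<And>z y. z \<in> K \<Longrightarrow> y \<in> K \<Longrightarrow> dist y z < d z \<Longrightarrow> u y < u (b z)"
    by blast
  have "K \<subseteq> (\<Union>z\<in>K. ball z (d z))" using d(1) by force
  then obtain D where D: "D \<subseteq> K" "finite D" "K \<subseteq> (\<Union>z\<in>D. ball z (d z))"
    using compactE_image[OF assms(1), of K "\<lambda>z. ball z (d z)"] by auto
  then have ne: "D \<noteq> {}" using assms(2) by auto
  define m where "m = Max ((\<lambda>z. u (b z)) ` D)"
  have "m \<in> (\<lambda>z. u (b z)) ` D" using D ne by (auto simp: m_def intro!: Max_in)
  then obtain z0 where z0: "z0 \<in> D" "m = u (b z0)" by auto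
  then have "b z0 \<in> K" using b(1) D by auto
  then obtain z1 where z1: "z1 \<in> D" "dist (b z0) z1 < d z1"
    using D by (auto simp: dist_commute)
  then have "m < u (b z1)" using d(2)[of z1 "b z0"] \<open>b z0 \<in> K\<close> D z0 by auto
  moreover have "u (b z1) \<le> m" unfolding m_def using z1 D by (intro Max_ge) auto
  ultimately show False by simp
qed

section \<open>Maxima, localization and translates of subharmonic functions\<close>

lemma subharmonic_max:
  assumes "open X" "subharmonic F X u" "subharmonic F X v"
  shows "subharmonic F X (\<lambda>x. max (u x) (v x))"
proof (rule subharmonicI[OF assms(1)])
  show "usc_on X (\<lambda>x. max (u x) (v x))"
    by (intro usc_on_max subharmonic_usc[OF assms(2)] subharmonic_usc[OF assms(3)])
  fix y U \<phi> G A
  assume *: "y \<in> U" "U \<subseteq> X" "C2_on U \<phi> G A" "\<And>x. x \<in> U \<Longrightarrow> max (u x) (v x) \<le> \<phi> x"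
    "max (u y) (v y) = \<phi> y"
  have y: "y \<in> X" using *(1,2) by auto
  show "A y \<in> F"
  proof (cases "u y = \<phi> y")
    case True
    show ?thesis by (rule subharmonicD[OF assms(2) y *(3,1) _ True]) (use *(4) in simp)
  next
    case False
    then have "v y = \<phi> y" using *(5) by linarith
    show ?thesis by (rule subharmonicD[OF assms(3) y *(3,1) _ \<open>v y = \<phi> y\<close>]) (use *(4) in simp)
  qed
qed

lemma usc_on_local:
  assumes "\<And>y. y \<in> X \<Longrightarrow> \<exists>N. open N \<and> y \<in> N \<and> usc_on (N \<inter> X) u"
  shows "usc_on X u"
  unfolding usc_on_def
proof (intro ballI allI impI)
  fix x and e :: real assume x: "x \<in> X" "e > 0"
  obtain N where N: "open N" "x \<in> N" "usc_on (N \<inter> X) u" using assms[OF x(1)] by blast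
  obtain r where r: "r > 0" "ball x r \<subseteq> N" using N openE by blast
  obtain d where d: "d > 0" "\<And>y. y \<in> N \<inter> X \<Longrightarrow> dist y x < d \<Longrightarrow> u y < u x + e"
    using usc_onD[OF N(3), of x e] x N by auto
  show "\<exists>d>0. \<forall>y\<in>X. dist y x < d \<longrightarrow> u y < u x + e"
    using d r by (intro exI[of _ "min d r"]) (auto simp: dist_commute subset_iff)
qed

lemma usc_on_cong: "usc_on X u \<Longrightarrow> (\<And>x. x \<in> X \<Longrightarrow> u x = v x) \<Longrightarrow> usc_on X v"
  unfolding usc_on_def by simp

text \<open>For functions given by cases: near each point \<open>u\<close> may be replaced by a
  function already known to be subharmonic, since the test condition sees only a
  neighbourhood.\<close>

lemma subharmonic_local:
  assumes "open X"
    and "\<And>y. y \<in> X \<Longrightarrow> \<exists>N v. open N \<and> y \<in> N \<and> subharmonic F (N \<inter> X) v \<and> (\<forall>x\<in>N \<inter> X. u x = v x)"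
  shows "subharmonic F X u"
proof (rule subharmonicI[OF assms(1)])
  show "usc_on X u"
  proof (rule usc_on_local)
    fix y assume "y \<in> X"
    then show "\<exists>N. open N \<and> y \<in> N \<and> usc_on (N \<inter> X) u"
      using assms(2)[of y] subharmonic_usc usc_on_cong[of _ _ u] by (metis (no_types, lifting))
  qed
  fix y U \<phi> G A
  assume *: "y \<in> U" "U \<subseteq> X" "C2_on U \<phi> G A" "\<And>x. x \<in> U \<Longrightarrow> u x \<le> \<phi> x" "u y = \<phi> y"
  have "y \<in> X" using *(1,2) by auto
  from assms(2)[OF this] obtain N v
    where N: "open N" "y \<in> N" "subharmonic F (N \<inter> X) v" "\<forall>x\<in>N \<inter> X. u x = v x" by blast
  show "A y \<in> F"
  proof (rule subharmonicD[OF N(3)])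
    show "C2_on (N \<inter> U) \<phi> G A"
      by (rule C2_on_subset[OF *(3)]) (use N(1) C2_onD(1)[OF *(3)] in auto)
    fix x assume "x \<in> N \<inter> U"
    then show "v x \<le> \<phi> x" using N(4) *(2) *(4)[of x] by auto
  qed (use N *(1,2,5) in auto)
qed

text \<open>\<open>F\<close> does not depend on the point, so translating and subtracting a constant
  leave the Hessians of test functions unchanged. Walsh's argument rests on this.\<close>

lemma subharmonic_translate:
  assumes "open X" "subharmonic F X u"
  shows "subharmonic F {x. x + y \<in> X} (\<lambda>x. u (x + y) - c)"
proof (rule subharmonicI)
  have "{x. x + y \<in> X} = (+) (- y) ` X" by (force simp: image_iff intro: bexI[where x = "_ + y"])
  then show "open {x. x + y \<in> X}" using open_translation[OF assms(1)] by metis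
  show "usc_on {x. x + y \<in> X} (\<lambda>x. u (x + y) - c)"
    unfolding usc_on_def
  proof (intro ballI allI impI)
    fix x and e :: real assume "x \<in> {x. x + y \<in> X}" "e > 0"
    then obtain d where "d > 0" "\<And>z. z \<in> X \<Longrightarrow> dist z (x + y) < d \<Longrightarrow> u z < u (x + y) + e"
      using usc_onD[OF subharmonic_usc[OF assms(2)], of "x + y" e] by auto
    then show "\<exists>d>0. \<forall>z\<in>{x. x + y \<in> X}. dist z x < d \<longrightarrow> u (z + y) - c < u (x + y) - c + e"
      by (intro exI[of _ d]) force
  qed
  fix z U \<phi> G A
  assume *: "z \<in> U" "U \<subseteq> {x. x + y \<in> X}" "C2_on U \<phi> G A" "\<And>x. x \<in> U \<Longrightarrow> u (x + y) - c \<le> \<phi> x"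
    "u (z + y) - c = \<phi> z"
  have C: "C2_on ((+) y ` U) (\<lambda>x. \<phi> (x - y) + c) (\<lambda>x. G (x - y)) (\<lambda>x. A (x - y))"
    using C2_on_affine[OF C2_on_translate[OF *(3), of "- y"], of 1 c] by simp
  have "A (z + y - y) \<in> F"
  proof (rule subharmonicD[OF assms(2) _ C])
    fix x assume "x \<in> (+) y ` U"
    then show "u x \<le> \<phi> (x - y) + c" using *(4)[of "x - y"] by auto
  qed (use * in \<open>auto simp: add.commute\<close>)
  then show "A z \<in> F" by simp
qed

section \<open>Cone subequations: smooth subsolutions, suprema and the dual\<close>

lemma cone_subequationD:
  assumes "cone_subequation F"
  shows "closed F" "A \<in> F \<Longrightarrow> A \<in> Sym" "A \<in> F \<Longrightarrow> psd P \<Longrightarrow> A + P \<in> F"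
    "t > 0 \<Longrightarrow> A \<in> F \<Longrightarrow> t *\<^sub>R A \<in> F" "t > 0 \<Longrightarrow> t *\<^sub>R A \<in> F \<Longrightarrow> A \<in> F"
proof -
  show "closed F" "A \<in> F \<Longrightarrow> A \<in> Sym" "A \<in> F \<Longrightarrow> psd P \<Longrightarrow> A + P \<in> F"
    using assms by (auto simp: cone_subequation_def)
  have s: "s *\<^sub>R B \<in> F" if "s > 0" "B \<in> F" for s B
    using assms that unfolding cone_subequation_def by blast
  then show "t > 0 \<Longrightarrow> A \<in> F \<Longrightarrow> t *\<^sub>R A \<in> F" .
  show "t > 0 \<Longrightarrow> t *\<^sub>R A \<in> F \<Longrightarrow> A \<in> F"
    using s[of "inverse t" "t *\<^sub>R A"] by simp
qed

lemma IntF_iff: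
  "A \<in> IntF F \<longleftrightarrow> A \<in> Sym \<and> (\<exists>e>0. \<forall>B\<in>Sym. dist B A < e \<longrightarrow> B \<in> F)"
proof
  assume "A \<in> IntF F"
  then obtain T where "openin (top_of_set Sym) T" "A \<in> T" "T \<subseteq> F"
    unfolding IntF_def interior_of_def by auto
  then show "A \<in> Sym \<and> (\<exists>e>0. \<forall>B\<in>Sym. dist B A < e \<longrightarrow> B \<in> F)"
    unfolding openin_euclidean_subtopology_iff by blast
next
  assume "A \<in> Sym \<and> (\<exists>e>0. \<forall>B\<in>Sym. dist B A < e \<longrightarrow> B \<in> F)"
  then obtain e where e: "A \<in> Sym" "e > 0" "\<And>B. B \<in> Sym \<Longrightarrow> dist B A < e \<Longrightarrow> B \<in> F" by blast
  have "openin (top_of_set Sym) (Sym \<inter> ball A e)" by (simp add: openin_open_Int)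
  moreover have "A \<in> Sym \<inter> ball A e" "Sym \<inter> ball A e \<subseteq> F" using e by (auto simp: dist_commute)
  ultimately show "A \<in> IntF F" unfolding IntF_def interior_of_def by blast
qed

lemma Sym_add: "A \<in> Sym \<Longrightarrow> B \<in> Sym \<Longrightarrow> A + B \<in> Sym"
  and Sym_scaleR: "A \<in> Sym \<Longrightarrow> c *\<^sub>R A \<in> Sym"
  and Sym_uminus: "A \<in> Sym \<Longrightarrow> - A \<in> Sym"
  and Sym_projline: "projline v \<in> Sym"
  by (auto simp: Sym_def transpose_def vec_eq_iff projline_def)

text \<open>A test function touching from above differs from \<open>\<psi>\<close> by a function
  with a local minimum, so its Hessian exceeds \<open>B\<close> by a positive semidefinite matrix,
  which \<open>F\<close> absorbs.\<close>

lemma C2_subharmonic: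
  assumes F: "cone_subequation F" and C: "C2_on U \<psi> H B" and BF: "\<And>x. x \<in> U \<Longrightarrow> B x \<in> F"
  shows "subharmonic F U \<psi>"
proof (rule subharmonicI[OF C2_onD(1)[OF C]])
  show "usc_on U \<psi>" by (rule continuous_imp_usc_on[OF C2_on_continuous[OF C]])
  fix y V \<phi> G A
  assume *: "y \<in> V" "V \<subseteq> U" "C2_on V \<phi> G A" "\<And>x. x \<in> V \<Longrightarrow> \<psi> x \<le> \<phi> x" "\<psi> y = \<phi> y"
  have "C2_on V (\<lambda>x. \<phi> x - \<psi> x) (\<lambda>x. G x - H x) (\<lambda>x. A x - B x)"
    by (rule C2_on_diff[OF *(3) C2_on_subset[OF C C2_onD(1)[OF *(3)] *(2)]])
  from C2_on_local_min_psd[OF this *(1)] have "psd (A y - B y)" using *(4,5) by simp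
  then show "A y \<in> F"
    using cone_subequationD(3)[OF F BF[of y]] * by fastforce
qed

text \<open>The test function is made strict by a small quadratic term. A member close to
  \<open>H\<close> at \<open>y\<close> is then touched by a vertical translate of it at an interior
  point \<open>z\<close> of a small ball, with a Hessian close to \<open>A y\<close>; closedness of
  \<open>F\<close> gives the limit.\<close>

lemma subharmonic_Sup:
  fixes F :: "(real^'n^'n) set"
  assumes "open X" "closed F" and usc: "usc_on X H"
    and fam: "\<And>u. u \<in> \<F> \<Longrightarrow> subharmonic F X u" "\<And>u x. u \<in> \<F> \<Longrightarrow> x \<in> X \<Longrightarrow> u x \<le> H x"
    and approx: "\<And>x e. x \<in> X \<Longrightarrow> e > 0 \<Longrightarrow> \<exists>u\<in>\<F>. H x - e < u x"
  shows "subharmonic F X H"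
proof (rule subharmonicI[OF assms(1) usc])
  fix y U \<phi> G A
  assume *: "y \<in> U" "U \<subseteq> X" "C2_on U \<phi> G A" "\<And>x. x \<in> U \<Longrightarrow> H x \<le> \<phi> x" "H y = \<phi> y"
  have "\<exists>B\<in>F. dist B (A y) < \<delta>" if \<delta>: "\<delta> > 0" for \<delta>
  proof -
    obtain d where d: "d > 0" "\<And>x. x \<in> U \<Longrightarrow> dist x y < d \<Longrightarrow> dist (A x) (A y) < \<delta> / 2"
      using C2_onD(2)[OF *(3)] * \<delta> unfolding continuous_on_iff by (meson half_gt_zero)
    obtain r0 where r0: "r0 > 0" "cball y r0 \<subseteq> U"
      using C2_onD(1)[OF *(3)] *(1) open_contains_cball by blast
    define r where "r = min r0 (d / 2)"
    have r: "r > 0" "cball y r \<subseteq> U" "r < d" using r0 d by (auto simp: r_def)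
    obtain \<eta> where \<eta>: "\<eta> > 0" and n: "norm ((2 * \<eta>) *\<^sub>R (mat 1 :: real^'n^'n)) \<le> \<delta> / 2"
      using small_multiple[of "\<delta> / 2" "mat 1 :: real^'n^'n"] \<delta> by auto
    define \<psi> where "\<psi> x = \<phi> x + \<eta> * (norm (x - y))\<^sup>2" for x
    have C: "C2_on U (\<lambda>x. \<psi> x + c) (\<lambda>x. G x + (2 * \<eta>) *\<^sub>R (x - y)) (\<lambda>x. A x + (2 * \<eta>) *\<^sub>R mat 1)" for c
      unfolding \<psi>_def by (rule C2_on_add_sqdist[OF *(3)])
    have yX: "y \<in> X" using * by auto
    \<comment> \<open>The tolerance \<open>\<eta> * r\<^sup>2\<close> is the excess of
      \<open>\<psi>\<close> over \<open>\<phi>\<close> on the sphere; it keeps the maximum point of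
      \<open>u - \<psi>\<close> strictly inside the ball.\<close>
    obtain u where u: "u \<in> \<F>" "H y - \<eta> * r\<^sup>2 < u y"
      using approx[OF yX, of "\<eta> * r\<^sup>2"] \<eta> r by auto
    have cont: "continuous_on (cball y r) \<psi>"
      using continuous_on_subset[OF C2_on_continuous[OF C[of 0]] r(2)] by simp
    have sub: "cball y r \<subseteq> X" using r * by auto
    have "usc_on (cball y r) (\<lambda>x. u x - \<psi> x)"
      by (intro usc_on_diff_continuous cont usc_on_subset[OF subharmonic_usc[OF fam(1)[OF u(1)]] sub])
    then obtain z where z: "z \<in> cball y r" "\<And>x. x \<in> cball y r \<Longrightarrow> u x - \<psi> x \<le> u z - \<psi> z"
      using usc_attains_max[of "cball y r" "\<lambda>x. u x - \<psi> x"] r by auto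
    have zU: "z \<in> U" using z r by auto
    have "\<eta> * (norm (z - y))\<^sup>2 < \<eta> * r\<^sup>2"
    proof -
      have "u y - \<psi> y \<le> u z - \<psi> z" using z(2)[of y] r by simp
      moreover have "u z \<le> \<phi> z" using fam(2)[OF u(1), of z] *(2,4) zU by force
      ultimately show ?thesis using u *(5) by (simp add: \<psi>_def)
    qed
    then have "(norm (z - y))\<^sup>2 < r\<^sup>2" using \<eta> by simp
    then have "norm (z - y) < r" by (rule power2_less_imp_less) (use r in simp)
    then have zb: "z \<in> ball y r" by (simp add: dist_norm norm_minus_commute)
    have bU: "ball y r \<subseteq> U" using r(2) ball_subset_cball by blast
    have "A z + (2 * \<eta>) *\<^sub>R mat 1 \<in> F"
    proof (rule subharmonicD[OF fam(1)[OF u(1)]])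
      show "C2_on (ball y r) (\<lambda>x. \<psi> x + (u z - \<psi> z)) (\<lambda>x. G x + (2 * \<eta>) *\<^sub>R (x - y))
             (\<lambda>x. A x + (2 * \<eta>) *\<^sub>R mat 1)"
        by (rule C2_on_subset[OF C _ bU]) simp
      fix x assume "x \<in> ball y r"
      then show "u x \<le> \<psi> x + (u z - \<psi> z)" using z(2)[of x] by simp
    qed (use zb *(2) zU in auto)
    moreover have "dist (A z + (2 * \<eta>) *\<^sub>R mat 1) (A y) < \<delta>"
    proof -
      have "dist (A z) (A y) < \<delta> / 2"
        using d(2)[OF zU] z r by (auto simp: dist_commute)
      moreover have "dist (A z + (2 * \<eta>) *\<^sub>R mat 1) (A y) \<le> norm ((2 * \<eta>) *\<^sub>R (mat 1 :: real^'n^'n)) + dist (A z) (A y)"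
        unfolding dist_norm
        using norm_triangle_ineq[of "(2 * \<eta>) *\<^sub>R (mat 1 :: real^'n^'n)" "A z - A y"]
        by (simp add: algebra_simps)
      ultimately show ?thesis using n by linarith
    qed
    ultimately show ?thesis by blast
  qed
  then have "A y \<in> closure F" by (simp add: closure_approachable)
  then show "A y \<in> F" using assms(2) by simp
qed

text \<open>Negation turns upper test functions for \<open>- w\<close> into lower test functions for
  \<open>w\<close>, so the dual condition becomes a ban on lower test functions with Hessian in
  \<open>IntF F\<close>.\<close>

lemma dual_subharmonicI:
  assumes "open X" "continuous_on X w"
    and "\<And>y U \<psi> G A. \<lbrakk>y \<in> U; U \<subseteq> X; C2_on U \<psi> G A;
           \<And>x. x \<in> U \<Longrightarrow> \<psi> x \<le> w x; \<psi> y = w y\<rbrakk> \<Longrightarrow> A y \<notin> IntF F"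
  shows "subharmonic (dual_subeq F) X (\<lambda>x. - w x)"
proof (rule subharmonicI[OF assms(1)])
  show "usc_on X (\<lambda>x. - w x)"
    by (intro continuous_imp_usc_on continuous_on_minus assms(2))
  fix y U \<phi> G A
  assume *: "y \<in> U" "U \<subseteq> X" "C2_on U \<phi> G A" "\<And>x. x \<in> U \<Longrightarrow> - w x \<le> \<phi> x" "- w y = \<phi> y"
  have "C2_on U (\<lambda>x. - \<phi> x) (\<lambda>x. - G x) (\<lambda>x. - A x)"
    using C2_on_affine[OF *(3), of "-1" 0] by simp
  then have "- A y \<notin> IntF F"
  proof (rule assms(3)[OF *(1,2)])
    fix x assume "x \<in> U"
    then show "- \<phi> x \<le> w x" using *(4)[of x] by simp
  qed (use *(5) in simp)
  then show "A y \<in> dual_subeq F"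
    using C2_on_Sym[OF *(3,1)] by (simp add: dual_subeq_def)
qed

lemma dual_subharmonicD:
  assumes "subharmonic (dual_subeq F) X (\<lambda>x. - w x)" "y \<in> X" "C2_on U \<psi> G A" "y \<in> U"
    "\<And>x. x \<in> U \<Longrightarrow> \<psi> x \<le> w x" "\<psi> y = w y"
  shows "A y \<notin> IntF F"
proof -
  have "C2_on U (\<lambda>x. - \<psi> x) (\<lambda>x. - G x) (\<lambda>x. - A x)"
    using C2_on_affine[OF assms(3), of "-1" 0] by simp
  from subharmonicD[OF assms(1,2) this assms(4)] have "- A y \<in> dual_subeq F"
    using assms by simp
  then show ?thesis by (simp add: dual_subeq_def)
qed

section \<open>Boundary barriers and supersolutions\<close>

lemma projline_scaleR: "projline (c *\<^sub>R v) = c\<^sup>2 *\<^sub>R projline v"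
  by (simp add: projline_def vec_eq_iff power2_eq_square)

lemma IntF_dest:
  assumes "A \<in> IntF F"
  obtains e where "e > 0" "\<And>B. B \<in> Sym \<Longrightarrow> dist B A < e \<Longrightarrow> B \<in> F"
  using assms unfolding IntF_iff by blast

lemma IntF_scaleR:
  assumes F: "cone_subequation F" and "A \<in> IntF F" "c > 0"
  shows "c *\<^sub>R A \<in> IntF F"
proof -
  obtain e where e: "e > 0" "\<And>B. B \<in> Sym \<Longrightarrow> dist B A < e \<Longrightarrow> B \<in> F"
    using IntF_dest[OF assms(2)] by blast
  have "B \<in> F" if B: "B \<in> Sym" "dist B (c *\<^sub>R A) < c * e" for B
  proof -
    have "dist B (c *\<^sub>R A) = norm (c *\<^sub>R ((1 / c) *\<^sub>R B - A))"
      using \<open>c > 0\<close> by (simp add: dist_norm scaleR_diff_right)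
    also have "\<dots> = c * dist ((1 / c) *\<^sub>R B) A"
      using \<open>c > 0\<close> by (simp add: dist_norm)
    finally have "dist B (c *\<^sub>R A) = c * dist ((1 / c) *\<^sub>R B) A" .
    then have "dist ((1 / c) *\<^sub>R B) A < e" using B \<open>c > 0\<close> by simp
    then have "(1 / c) *\<^sub>R B \<in> F" using e(2) Sym_scaleR[OF B(1)] by blast
    then show ?thesis using cone_subequationD(5)[OF F, of "1 / c"] \<open>c > 0\<close> by simp
  qed
  moreover have "c * e > 0" "c *\<^sub>R A \<in> Sym"
    using assms e(1) Sym_scaleR unfolding IntF_iff by auto
  ultimately show ?thesis unfolding IntF_iff by blast
qed

text \<open>One matrix serves both barriers. For large \<open>t\<close> the Hessian of
  \<open>\<rho>\<close> plus \<open>t\<close> times the normal projection lies in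
  \<open>IntF F\<close> by convexity, while its negative divided by \<open>t\<close> is close to
  minus that projection and hence avoids the closed set \<open>F\<close>. Both properties persist
  near \<open>p\<close> and under a small quadratic perturbation.\<close>

lemma boundary_barrier:
  fixes F :: "(real^'n^'n) set" and \<Omega> :: "(real^'n) set"
  assumes F: "cone_subequation F" and negP: "\<forall>e. norm e = 1 \<longrightarrow> - projline e \<notin> F"
    and "open \<Omega>" and p: "p \<in> frontier \<Omega>"
    and smooth: "smooth_boundary \<Omega>" and convex: "strictly_F_convex_boundary F \<Omega>"
  obtains r \<eta> q G A where "r > 0" "\<eta> > 0" "C2_on (ball p r) q G A" "q p = 0"
    "\<And>x. x \<in> ball p r \<Longrightarrow> x \<in> closure \<Omega> \<Longrightarrow> q x \<le> - (\<eta> * (norm (x - p))\<^sup>2)"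
    "\<And>x. x \<in> ball p r \<Longrightarrow> A x \<in> F" "\<And>x. x \<in> ball p r \<Longrightarrow> - A x \<notin> F"
proof -
  obtain \<rho> where ldf: "local_defining_function \<Omega> p \<rho>"
    using smooth p unfolding smooth_boundary_def by blast
  then obtain U where U: "open U" "p \<in> U" "smooth_on U \<rho>"
    "\<And>y. y \<in> U \<Longrightarrow> y \<in> \<Omega> \<longleftrightarrow> \<rho> y < 0" "grad \<rho> p \<noteq> 0"
    unfolding local_defining_function_def by blast
  have C: "C2_on U \<rho> (grad \<rho>) (hessian \<rho>)"
    using U(1,3) Ck2_imp_C2_on unfolding smooth_on_def by blast
  have le0: "\<rho> x \<le> 0" if "x \<in> U" "x \<in> closure \<Omega>" for x
  proof (rule ccontr)
    assume "\<not> \<rho> x \<le> 0"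
    define V where "V = \<rho> -` {0<..} \<inter> U"
    have "open V" unfolding V_def
      using continuous_on_open_vimage[OF U(1)] C2_on_continuous[OF C] open_greaterThan by blast
    moreover have "V \<inter> \<Omega> = {}" using U(4) by (force simp: V_def)
    ultimately have "V \<inter> closure \<Omega> = {}" by (simp add: open_Int_closure_eq_empty)
    moreover have "x \<in> V" using that \<open>\<not> \<rho> x \<le> 0\<close> by (simp add: V_def)
    ultimately show False using that by blast
  qed
  have "p \<notin> \<Omega>" "p \<in> closure \<Omega>"
    using p \<open>open \<Omega>\<close> by (auto simp: frontier_def interior_open)
  then have \<rho>p: "\<rho> p = 0" using le0[OF U(2)] U(4)[OF U(2)] by force
  define g where "g = grad \<rho> p"
  define e where "e = (1 / norm g) *\<^sub>R g"
  have g: "norm g > 0" using U(5) by (simp add: g_def)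
  have ne: "norm e = 1" using g by (simp add: e_def)
  obtain T where T: "\<And>t. t \<ge> T \<Longrightarrow> hessian \<rho> p + t *\<^sub>R projline e \<in> IntF F"
    using convex p ldf unfolding strictly_F_convex_boundary_def e_def g_def by blast
  have "open (- F)" using cone_subequationD(1)[OF F] by (simp add: open_Compl)
  moreover have "- projline e \<in> - F" using negP ne by simp
  ultimately obtain d where d: "d > 0" "ball (- projline e) d \<subseteq> - F"
    using open_contains_ball by blast
  \<comment> \<open>The last bound makes the Hessian of \<open>\<rho>\<close> divided by
    \<open>t\<close> smaller than \<open>d\<close>, so that \<open>- B\<close>, rescaled, stays in
    the ball around \<open>- projline e\<close> that misses \<open>F\<close>.\<close>
  define t where "t = max (max T 1) (norm (hessian \<rho> p) / d + 1)"
  have t: "t > 0" "t \<ge> T" "norm (hessian \<rho> p) / d < t" by (auto simp: t_def)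
  define B where "B = hessian \<rho> p + t *\<^sub>R projline e"
  have B1: "B \<in> IntF F" unfolding B_def by (rule T[OF t(2)])
  have B2: "- B \<notin> F"
  proof
    assume "- B \<in> F"
    then have "(1 / t) *\<^sub>R (- B) \<in> F" by (intro cone_subequationD(4)[OF F]) (use t in simp)
    moreover have "(1 / t) *\<^sub>R (- B) = - projline e - (1 / t) *\<^sub>R hessian \<rho> p"
      using t by (simp add: B_def algebra_simps)
    moreover have "dist (- projline e) (- projline e - (1 / t) *\<^sub>R hessian \<rho> p) < d"
    proof -
      have "norm (hessian \<rho> p) < t * d" using t d by (simp add: field_simps)
      then show ?thesis using t by (simp add: dist_norm field_simps)
    qed
    ultimately show False using d(2) by (auto simp: subset_iff)
  qed
  obtain e1 where e1: "e1 > 0" "\<And>D. D \<in> Sym \<Longrightarrow> dist D B < e1 \<Longrightarrow> D \<in> F"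
    using IntF_dest[OF B1] by blast
  obtain e2 where e2: "e2 > 0" "ball (- B) e2 \<subseteq> - F"
    using \<open>open (- F)\<close> B2 open_contains_ball by blast
  have near: "D \<in> F" "- D \<notin> F" if "D \<in> Sym" "dist D B < min e1 e2" for D
  proof -
    show "D \<in> F" using e1(2)[OF that(1)] that(2) by simp
    have "dist (- B) (- D) = dist D B" by (simp add: dist_norm norm_minus_commute)
    then have "- D \<in> ball (- B) e2" using that(2) by simp
    then show "- D \<notin> F" using e2(2) by blast
  qed
  \<comment> \<open>The square term produces the projection along the unnormalized gradient;
    dividing by \<open>(norm g)\<^sup>2\<close> turns it into \<open>t *\<^sub>R projline e\<close>
    at \<open>p\<close>, where \<open>\<rho>\<close> vanishes.\<close>
  define s where "s = t / (norm g)\<^sup>2"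
  have s: "s > 0" using t g by (simp add: s_def)
  define A0 where "A0 x = (1 + s * \<rho> x) *\<^sub>R hessian \<rho> x + s *\<^sub>R projline (grad \<rho> x)" for x
  define q0 where "q0 x = \<rho> x + (s / 2) * (\<rho> x)\<^sup>2" for x
  define G0 where "G0 x = (1 + s * \<rho> x) *\<^sub>R grad \<rho> x" for x
  have C0: "C2_on U q0 G0 A0"
    unfolding q0_def G0_def A0_def by (rule C2_on_add_square[OF C])
  have A0p: "A0 p = B"
    using g by (simp add: A0_def B_def \<rho>p s_def e_def projline_scaleR power_divide flip: g_def)
  \<comment> \<open>The tolerance is split evenly between the quadratic perturbation and the
    variation of \<open>A0\<close>.\<close>
  have m: "min e1 e2 / 2 > 0" using e1 e2 by simp
  obtain \<eta> where \<eta>: "\<eta> > 0" "norm ((2 * \<eta>) *\<^sub>R (mat 1 :: real^'n^'n)) \<le> min e1 e2 / 2"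
    using small_multiple[OF m, of "mat 1 :: real^'n^'n"] by blast
  define q where "q x = q0 x + (- \<eta>) * (norm (x - p))\<^sup>2 + 0" for x
  define A where "A x = A0 x + (2 * (- \<eta>)) *\<^sub>R mat 1" for x
  have Cq: "C2_on U q (\<lambda>x. G0 x + (2 * (- \<eta>)) *\<^sub>R (x - p)) A"
    unfolding q_def A_def by (rule C2_on_add_sqdist[OF C0])
  obtain d1 where d1: "d1 > 0" "\<And>x. x \<in> U \<Longrightarrow> dist x p < d1 \<Longrightarrow> dist (A0 x) (A0 p) < min e1 e2 / 2"
    using C2_onD(2)[OF C0] U(2) m unfolding continuous_on_iff by blast
  \<comment> \<open>When \<open>\<rho>\<close> is within \<open>2 / s\<close> of zero the factor
    \<open>1 + s / 2 * \<rho> x\<close> is nonnegative, so the square cannot spoil the sign of the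
    nonpositive \<open>\<rho>\<close>.\<close>
  have "2 / s > 0" using s by simp
  then obtain d2 where d2: "d2 > 0" "\<And>x. x \<in> U \<Longrightarrow> dist x p < d2 \<Longrightarrow> dist (\<rho> x) (\<rho> p) < 2 / s"
    using C2_on_continuous[OF C] U(2) unfolding continuous_on_iff by blast
  obtain d3 where d3: "d3 > 0" "ball p d3 \<subseteq> U" using U(1,2) openE by blast
  define r where "r = min d1 (min d2 d3)"
  have sub: "ball p r \<subseteq> U" using d3 by (auto simp: r_def subset_iff)
  show thesis
  proof (rule that)
    show "r > 0" using d1 d2 d3 by (simp add: r_def)
    show "\<eta> > 0" by fact
    show Cr: "C2_on (ball p r) q (\<lambda>x. G0 x + (2 * (- \<eta>)) *\<^sub>R (x - p)) A"
      by (rule C2_on_subset[OF Cq _ sub]) simp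
    show "q p = 0" by (simp add: q_def q0_def \<rho>p)
    fix x assume x: "x \<in> ball p r"
    then have xU: "x \<in> U" using sub by blast
    show "q x \<le> - (\<eta> * (norm (x - p))\<^sup>2)" if "x \<in> closure \<Omega>"
    proof -
      have r0: "\<rho> x \<le> 0" using le0[OF xU that] .
      have "dist (\<rho> x) (\<rho> p) < 2 / s" using d2(2)[OF xU] x by (simp add: r_def dist_commute)
      then have "- \<rho> x < 2 / s" using \<rho>p r0 by (simp add: dist_real_def)
      then have "0 \<le> 1 + s / 2 * \<rho> x" using s by (simp add: field_simps)
      then have "\<rho> x * (1 + s / 2 * \<rho> x) \<le> 0" using r0 by (rule mult_nonpos_nonneg[rotated])
      then have "q0 x \<le> 0" by (simp add: q0_def power2_eq_square algebra_simps)
      then show ?thesis by (simp add: q_def)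
    qed
    have "dist (A x) B < min e1 e2"
    proof -
      have "dist (A0 x) B < min e1 e2 / 2" using d1(2)[OF xU] x A0p by (simp add: r_def dist_commute)
      moreover have "dist (A x) B \<le> norm (A0 x - B) + norm ((2 * \<eta>) *\<^sub>R (mat 1 :: real^'n^'n))"
        unfolding dist_norm using norm_triangle_ineq4[of "A0 x - B" "(2 * \<eta>) *\<^sub>R (mat 1 :: real^'n^'n)"]
        by (simp add: A_def algebra_simps)
      ultimately show ?thesis using \<eta>(2) unfolding dist_norm by linarith
    qed
    with near[OF C2_on_Sym[OF Cr x]] show "A x \<in> F" "- A x \<notin> F" by auto
  qed
qed

text \<open>At a maximum \<open>- A y\<close> is positive semidefinite. If \<open>A y\<close> were
  interior to \<open>F\<close>, a small multiple of a projection could be subtracted, and adding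
  \<open>- A y\<close> would leave a negative multiple of a projection in \<open>F\<close>.\<close>

lemma dual_subharmonic_const:
  fixes F :: "(real^'n^'n) set"
  assumes F: "cone_subequation F" and negP: "\<forall>e. norm e = 1 \<longrightarrow> - projline e \<notin> F"
    and X: "open X"
  shows "subharmonic (dual_subeq F) X (\<lambda>x. - M)"
proof (rule dual_subharmonicI[OF X])
  show "continuous_on X (\<lambda>x. M)" by simp
  fix y U \<psi> G A
  assume *: "y \<in> U" "U \<subseteq> X" "C2_on U \<psi> G A" "\<And>x. x \<in> U \<Longrightarrow> \<psi> x \<le> M" "\<psi> y = M"
  have C: "C2_on U (\<lambda>x. - \<psi> x) (\<lambda>x. - G x) (\<lambda>x. - A x)"
    using C2_on_affine[OF *(3), of "-1" 0] by simp
  have psd: "psd (- A y)"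
    by (rule C2_on_local_min_psd[OF C *(1)]) (use *(4,5) in simp)
  show "A y \<notin> IntF F"
  proof
    assume "A y \<in> IntF F"
    then obtain e where e: "e > 0" "\<And>B. B \<in> Sym \<Longrightarrow> dist B (A y) < e \<Longrightarrow> B \<in> F"
      using IntF_dest by blast
    \<comment> \<open>Any unit vector works; \<open>undefined\<close> just names some
      coordinate.\<close>
    define v :: "real^'n" where "v = axis undefined 1"
    have v: "norm v = 1" by (simp add: v_def)
    obtain s where s: "s > 0" "norm ((2 * s) *\<^sub>R projline v) \<le> e / 2"
      using small_multiple[of "e / 2" "projline v"] e by auto
    have "A y - (2 * s) *\<^sub>R projline v \<in> Sym"
      using Sym_add[OF C2_on_Sym[OF *(3,1)] Sym_uminus[OF Sym_scaleR[OF Sym_projline]]] by simp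
    moreover have "dist (A y - (2 * s) *\<^sub>R projline v) (A y) < e"
      using s e by (simp add: dist_norm)
    ultimately have "A y - (2 * s) *\<^sub>R projline v \<in> F" by (rule e(2))
    from cone_subequationD(3)[OF F this psd] have "(2 * s) *\<^sub>R (- projline v) \<in> F" by simp
    then have "- projline v \<in> F" using cone_subequationD(5)[OF F, of "2 * s"] s by simp
    then show False using negP v by blast
  qed
qed

text \<open>Constants do not affect Hessians, and the positive factor \<open>c\<close> is absorbed
  because \<open>IntF F\<close> is a cone.\<close>

lemma dual_subharmonic_affine:
  assumes F: "cone_subequation F" and X: "open X" and u: "continuous_on X u"
    and sub: "subharmonic (dual_subeq F) X (\<lambda>x. - u x)" and c: "c > 0"
  shows "subharmonic (dual_subeq F) X (\<lambda>x. - (a + c * (u x - b)))"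
proof (rule dual_subharmonicI[OF X])
  show "continuous_on X (\<lambda>x. a + c * (u x - b))" by (intro continuous_intros u)
  fix y U \<psi> G A
  assume *: "y \<in> U" "U \<subseteq> X" "C2_on U \<psi> G A" "\<And>x. x \<in> U \<Longrightarrow> \<psi> x \<le> a + c * (u x - b)"
    "\<psi> y = a + c * (u y - b)"
  have y: "y \<in> X" using *(1,2) by blast
  have "(1 / c) *\<^sub>R A y \<notin> IntF F"
  proof (rule dual_subharmonicD[OF sub y C2_on_affine[OF *(3), of "1 / c" "b - a / c"] *(1)])
    fix x assume "x \<in> U"
    then show "1 / c * \<psi> x + (b - a / c) \<le> u x" using *(4)[of x] c by (simp add: field_simps)
  qed (use *(5) c in \<open>simp add: field_simps\<close>)
  then show "A y \<notin> IntF F" using IntF_scaleR[OF F, of "A y" "1 / c"] c by auto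
qed

section \<open>Perron's method below an obstacle\<close>

text \<open>The Perron construction sees the singular functions only through \<open>w\<close>. Since
  \<open>w\<close> lies above \<open>h\<close> and agrees with it on \<open>S\<close>, every
  function in between is pinned there.\<close>

locale obstacle_problem =
  fixes F :: "(real^'n^'n) set" and \<Omega> S :: "(real^'n) set" and \<phi> h w :: "real^'n \<Rightarrow> real"
  assumes F: "cone_subequation F"
    and negP: "\<forall>e. norm e = 1 \<longrightarrow> - projline e \<notin> F"
    and domain: "open \<Omega>" "bounded \<Omega>"
    and smooth: "smooth_boundary \<Omega>" and convex: "strictly_F_convex_boundary F \<Omega>"
    and S: "finite S" "S \<subseteq> \<Omega>"
    and phi: "continuous_on (frontier \<Omega>) \<phi>"
    and h_cont: "continuous_on (closure \<Omega>) h"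
    and h_sub: "subharmonic F (\<Omega> - S) h"
    and h_le_phi: "\<And>x. x \<in> frontier \<Omega> \<Longrightarrow> h x \<le> \<phi> x"
    and w_cont: "continuous_on (closure \<Omega>) w"
    and w_super: "subharmonic (dual_subeq F) (\<Omega> - S) (\<lambda>x. - w x)"
    and h_le_w: "\<And>x. x \<in> closure \<Omega> \<Longrightarrow> h x \<le> w x"
    and phi_le_w: "\<And>x. x \<in> frontier \<Omega> \<Longrightarrow> \<phi> x \<le> w x"
    and w_eq_h: "\<And>x. x \<in> S \<Longrightarrow> w x = h x"
begin

section \<open>The Perron family and gluing\<close>

definition perron_family :: "(real^'n \<Rightarrow> real) set" where
  "perron_family = {u. usc_on (closure \<Omega>) u \<and> subharmonic F (\<Omega> - S) u \<and>
     (\<forall>x\<in>closure \<Omega>. u x \<le> w x) \<and> (\<forall>x\<in>frontier \<Omega>. u x \<le> \<phi> x)}"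

text \<open>On \<open>closure \<Omega>\<close> the family contains \<open>h\<close> and is bounded
  above by \<open>w\<close>, so the supremum is genuine there. No upper regularization is taken;
  continuity is proved for the plain envelope.\<close>

definition H :: "real^'n \<Rightarrow> real" where "H x = (SUP u\<in>perron_family. u x)"

lemma famD:
  assumes "u \<in> perron_family"
  shows "usc_on (closure \<Omega>) u" "subharmonic F (\<Omega> - S) u"
    "x \<in> closure \<Omega> \<Longrightarrow> u x \<le> w x" "x \<in> frontier \<Omega> \<Longrightarrow> u x \<le> \<phi> x"
  using assms by (auto simp: perron_family_def)

lemma open_X: "open (\<Omega> - S)"
  using domain S by (simp add: open_Diff finite_imp_closed)

lemma in_closure: "x \<in> \<Omega> \<Longrightarrow> x \<in> closure \<Omega>" "x \<in> frontier \<Omega> \<Longrightarrow> x \<in> closure \<Omega>"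
  using closure_subset by (auto simp: frontier_def)

lemma frontier_disjoint: "x \<in> frontier \<Omega> \<Longrightarrow> x \<notin> \<Omega>"
  using domain(1) by (auto simp: frontier_def interior_open)

lemma closure_cases: "x \<in> closure \<Omega> \<Longrightarrow> x \<in> \<Omega> \<or> x \<in> frontier \<Omega>"
  using domain(1) by (auto simp: frontier_def interior_open)

lemma compact_closure: "compact (closure \<Omega>)"
  using domain(2) by simp

lemma h_fam: "h \<in> perron_family"
  unfolding perron_family_def using continuous_imp_usc_on[OF h_cont] h_sub h_le_w h_le_phi by auto

lemma bdd_fam: "x \<in> closure \<Omega> \<Longrightarrow> bdd_above ((\<lambda>u. u x) ` perron_family)"
  by (auto intro!: bdd_aboveI[of _ "w x"] famD(3))

lemma fam_le_H: "u \<in> perron_family \<Longrightarrow> x \<in> closure \<Omega> \<Longrightarrow> u x \<le> H x"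
  unfolding H_def by (intro cSUP_upper bdd_fam)

lemma H_least: "(\<And>u. u \<in> perron_family \<Longrightarrow> u x \<le> c) \<Longrightarrow> H x \<le> c"
  unfolding H_def using h_fam by (intro cSUP_least) auto

lemma H_approx:
  assumes "x \<in> closure \<Omega>" "e > 0"
  shows "\<exists>u\<in>perron_family. H x - e < u x"
proof (rule ccontr)
  assume "\<not> ?thesis"
  then have "H x \<le> H x - e" by (intro H_least) (auto simp: not_less)
  then show False using assms by simp
qed

lemma H_le_w: "x \<in> closure \<Omega> \<Longrightarrow> H x \<le> w x"
  by (intro H_least famD(3))

lemma h_le_H: "x \<in> closure \<Omega> \<Longrightarrow> h x \<le> H x"
  by (intro fam_le_H h_fam)

lemma fam_max:
  assumes "u \<in> perron_family" "v \<in> perron_family"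
  shows "(\<lambda>x. max (u x) (v x)) \<in> perron_family"
  unfolding perron_family_def
  using usc_on_max[OF famD(1)[OF assms(1)] famD(1)[OF assms(2)]]
    subharmonic_max[OF open_X famD(2)[OF assms(1)] famD(2)[OF assms(2)]]
    famD(3,4)[OF assms(1)] famD(3,4)[OF assms(2)] by simp

text \<open>Because \<open>g\<close> is below \<open>u\<close> on \<open>N\<close> outside
  \<open>C\<close>, within \<open>closure \<Omega>\<close> the glued function equals
  \<open>u\<close> off the closed set \<open>C\<close>. The open sets \<open>N\<close> and
  \<open>- C\<close> cover the space, and membership is local apart from pointwise bounds. It is
  applied to boundary barriers, to translates and to the Perron bump.\<close>

lemma fam_glue:
  assumes u: "u \<in> perron_family" and N: "open N" and C: "closed C" "C \<subseteq> N"
    and g: "usc_on (N \<inter> closure \<Omega>) g" "subharmonic F (N \<inter> (\<Omega> - S)) g"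
    and gw: "\<And>x. x \<in> N \<Longrightarrow> x \<in> closure \<Omega> \<Longrightarrow> g x \<le> w x"
    and gphi: "\<And>x. x \<in> N \<Longrightarrow> x \<in> frontier \<Omega> \<Longrightarrow> g x \<le> \<phi> x"
    and gu: "\<And>x. x \<in> N \<Longrightarrow> x \<notin> C \<Longrightarrow> x \<in> closure \<Omega> \<Longrightarrow> g x \<le> u x"
  shows "(\<lambda>x. if x \<in> N then max (u x) (g x) else u x) \<in> perron_family"
proof -
  define v where "v x = (if x \<in> N then max (u x) (g x) else u x)" for x
  have vN: "v x = max (u x) (g x)" if "x \<in> N" for x using that by (simp add: v_def)
  have vC: "v x = u x" if "x \<in> - C" "x \<in> closure \<Omega>" for x using that gu[of x] by (auto simp: v_def)
  have oC: "open (- C)" using C(1) by (simp add: open_Compl)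
  have "usc_on (closure \<Omega>) v"
  proof (rule usc_on_local)
    fix y assume "y \<in> closure \<Omega>"
    have "usc_on (N \<inter> closure \<Omega>) (\<lambda>x. max (u x) (g x))"
      by (intro usc_on_max g(1) usc_on_subset[OF famD(1)[OF u]]) simp
    then have 1: "usc_on (N \<inter> closure \<Omega>) v" by (rule usc_on_cong) (simp add: vN)
    have "usc_on (- C \<inter> closure \<Omega>) u" by (rule usc_on_subset[OF famD(1)[OF u]]) simp
    then have 2: "usc_on (- C \<inter> closure \<Omega>) v" by (rule usc_on_cong) (simp add: vC)
    show "\<exists>N. open N \<and> y \<in> N \<and> usc_on (N \<inter> closure \<Omega>) v"
      using 1 2 N oC C(2) by (cases "y \<in> N") blast+
  qed
  moreover have "subharmonic F (\<Omega> - S) v"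
  proof (rule subharmonic_local[OF open_X])
    fix y assume "y \<in> \<Omega> - S"
    have oN: "open (N \<inter> (\<Omega> - S))" using N open_X by blast
    have sN: "subharmonic F (N \<inter> (\<Omega> - S)) u" by (rule subharmonic_subset[OF famD(2)[OF u]]) simp
    have 1: "subharmonic F (N \<inter> (\<Omega> - S)) (\<lambda>x. max (u x) (g x))"
      by (rule subharmonic_max[OF oN sN g(2)])
    have 2: "subharmonic F (- C \<inter> (\<Omega> - S)) u" by (rule subharmonic_subset[OF famD(2)[OF u]]) simp
    show "\<exists>N v'. open N \<and> y \<in> N \<and> subharmonic F (N \<inter> (\<Omega> - S)) v' \<and>
            (\<forall>x\<in>N \<inter> (\<Omega> - S). v x = v' x)"
    proof (cases "y \<in> N")
      case True
      then show ?thesis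
        using N 1 vN by (intro exI[of _ N] exI[of _ "\<lambda>x. max (u x) (g x)"]) simp
    next
      case False
      then show ?thesis
        using oC 2 vC C(2) in_closure by (intro exI[of _ "- C"] exI[of _ u]) auto
    qed
  qed
  moreover have "\<forall>x\<in>closure \<Omega>. v x \<le> w x" "\<forall>x\<in>frontier \<Omega>. v x \<le> \<phi> x"
    using famD(3,4)[OF u] gw gphi by (auto simp: v_def)
  ultimately show ?thesis by (simp add: perron_family_def flip: v_def)
qed

section \<open>Control near the boundary and at the singular points\<close>

lemma closure_bound:
  obtains M where "M > 0" "\<And>x. x \<in> closure \<Omega> \<Longrightarrow> - M \<le> h x" "\<And>x. x \<in> closure \<Omega> \<Longrightarrow> w x \<le> M"
proof -
  have "bounded (h ` closure \<Omega>)" "bounded (w ` closure \<Omega>)"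
    using compact_continuous_image[OF h_cont compact_closure]
      compact_continuous_image[OF w_cont compact_closure] compact_imp_bounded by auto
  then obtain a b where "\<And>x. x \<in> closure \<Omega> \<Longrightarrow> norm (h x) \<le> a" "\<And>x. x \<in> closure \<Omega> \<Longrightarrow> norm (w x) \<le> b"
    unfolding bounded_iff by blast
  then show thesis by (intro that[of "max 1 (max a b)"]) (fastforce simp: abs_le_iff)+
qed

text \<open>A large multiple of the barrier \<open>q\<close> serves on both sides: shifted and glued
  to \<open>h\<close> it gives the member \<open>v\<close>, and its negative, shifted, bounds all
  members at once, so that the bound passes to \<open>H\<close>.\<close>

lemma boundary_control:
  assumes p: "p \<in> frontier \<Omega>" and \<epsilon>: "\<epsilon> > 0"
  shows "\<exists>v\<in>perron_family. \<exists>r>0. \<forall>x\<in>ball p r \<inter> closure \<Omega>. \<phi> p - \<epsilon> \<le> v x \<and> H x \<le> \<phi> p + \<epsilon>"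
proof -
  obtain r0 \<eta> q G A where r0: "r0 > 0" and \<eta>: "\<eta> > 0" and C: "C2_on (ball p r0) q G A" and qp: "q p = 0"
    and q: "\<And>x. x \<in> ball p r0 \<Longrightarrow> x \<in> closure \<Omega> \<Longrightarrow> q x \<le> - (\<eta> * (norm (x - p))\<^sup>2)"
    and A: "\<And>x. x \<in> ball p r0 \<Longrightarrow> A x \<in> F" and nA: "\<And>x. x \<in> ball p r0 \<Longrightarrow> - A x \<notin> F"
    using boundary_barrier[OF F negP domain(1) p smooth convex] by blast
  have e2: "\<epsilon> / 2 > 0" using \<epsilon> by simp
  have pc: "p \<in> closure \<Omega>" using in_closure p by blast
  obtain d1 where d1: "d1 > 0" "\<And>x. x \<in> frontier \<Omega> \<Longrightarrow> dist x p < d1 \<Longrightarrow> dist (\<phi> x) (\<phi> p) < \<epsilon> / 2"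
    using phi p e2 unfolding continuous_on_iff by blast
  obtain d2 where d2: "d2 > 0" "\<And>x. x \<in> closure \<Omega> \<Longrightarrow> dist x p < d2 \<Longrightarrow> dist (w x) (w p) < \<epsilon> / 2"
    using w_cont pc e2 unfolding continuous_on_iff by blast
  have "p \<notin> S" using frontier_disjoint p S by blast
  then obtain d3 where d3: "d3 > 0" "ball p d3 \<subseteq> - S"
    using finite_imp_closed[OF S(1)] open_contains_ball[of "- S"] by (auto simp: open_Compl)
  \<comment> \<open>Halving keeps the closed ball of radius \<open>R\<close> within the barrier
    ball; there \<open>\<phi>\<close> and \<open>w\<close> vary by less than
    \<open>\<epsilon> / 2\<close>, and \<open>S\<close> is avoided.\<close>
  define R where "R = min (min r0 d1) (min d2 d3) / 2"
  have R: "R > 0" "R < r0" "R < d1" "R < d2" "R < d3"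
    using r0 d1 d2 d3 by (auto simp: R_def)
  have bR: "cball p R \<subseteq> ball p r0" using R by (auto simp: subset_iff)
  obtain M where M: "M > 0" "\<And>x. x \<in> closure \<Omega> \<Longrightarrow> - M \<le> h x" "\<And>x. x \<in> closure \<Omega> \<Longrightarrow> w x \<le> M"
    using closure_bound by blast
  \<comment> \<open>Chosen so that \<open>c * q\<close> is at most
    \<open>- M - \<bar>\<phi> p\<bar>\<close> from distance \<open>R / 2\<close> on: this puts the
    lower barrier below \<open>h\<close> and, since \<open>u \<le> M\<close>, excludes far maxima
    for the upper one.\<close>
  define c where "c = (M + \<bar>\<phi> p\<bar>) / (\<eta> * (R / 2)\<^sup>2)"
  have pos: "\<eta> * (R / 2)\<^sup>2 > 0" using \<eta> R by simp
  have c: "c > 0" "c * (\<eta> * (R / 2)\<^sup>2) = M + \<bar>\<phi> p\<bar>" using pos M(1) by (auto simp: c_def)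
  have cq0: "c * q x \<le> 0" if "x \<in> ball p r0" "x \<in> closure \<Omega>" for x
  proof -
    have "\<eta> * (norm (x - p))\<^sup>2 \<ge> 0" using \<eta> by simp
    then have "q x \<le> 0" using q[OF that] by linarith
    then show ?thesis using c by (simp add: mult_le_0_iff)
  qed
  have cqR: "c * q x \<le> - M - \<bar>\<phi> p\<bar>" if "x \<in> ball p r0" "x \<in> closure \<Omega>" "norm (x - p) \<ge> R / 2" for x
  proof -
    have "(R / 2)\<^sup>2 \<le> (norm (x - p))\<^sup>2" using that(3) R by (intro power_mono) auto
    then have "q x \<le> - (\<eta> * (R / 2)\<^sup>2)"
      using q[OF that(1,2)] \<eta> by (smt (verit) mult_left_mono)
    then have "c * q x \<le> c * (- (\<eta> * (R / 2)\<^sup>2))" using c by (intro mult_left_mono) auto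
    then show ?thesis using c(2) by simp
  qed
  have contq: "continuous_on (ball p r0) q" by (rule C2_on_continuous[OF C])
  define g where "g x = c * q x + (\<phi> p - \<epsilon> / 2)" for x
  have Cg: "C2_on (ball p R) g (\<lambda>x. c *\<^sub>R G x) (\<lambda>x. c *\<^sub>R A x)"
    unfolding g_def by (rule C2_on_affine[OF C2_on_subset[OF C]]) (use bR in auto)
  have inb: "x \<in> ball p r0" if "x \<in> ball p R" for x using that R by simp
  have lower: "(\<lambda>x. if x \<in> ball p R then max (h x) (g x) else h x) \<in> perron_family"
  proof (rule fam_glue[OF h_fam])
    show "open (ball p R)" "closed (cball p (R / 2))" "cball p (R / 2) \<subseteq> ball p R" using R by auto
    show "usc_on (ball p R \<inter> closure \<Omega>) g"
      by (intro continuous_imp_usc_on continuous_on_subset[OF C2_on_continuous[OF Cg]]) simp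
    have "subharmonic F (ball p R) g"
      by (rule C2_subharmonic[OF F Cg]) (use cone_subequationD(4)[OF F c(1)] A inb in blast)
    then show "subharmonic F (ball p R \<inter> (\<Omega> - S)) g" by (rule subharmonic_subset) simp
  next
    fix x assume x: "x \<in> ball p R" "x \<in> closure \<Omega>"
    have "dist (w x) (w p) < \<epsilon> / 2" using d2(2)[OF x(2)] x(1) R by (simp add: dist_commute)
    then have "w x > \<phi> p - \<epsilon> / 2" using phi_le_w[OF p] unfolding dist_real_def by linarith
    then show "g x \<le> w x" using cq0[OF inb[OF x(1)] x(2)] by (simp add: g_def)
  next
    fix x assume x: "x \<in> ball p R" "x \<in> frontier \<Omega>"
    have "dist (\<phi> x) (\<phi> p) < \<epsilon> / 2" using d1(2)[OF x(2)] x(1) R by (simp add: dist_commute)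
    then have "\<phi> x > \<phi> p - \<epsilon> / 2" unfolding dist_real_def by linarith
    then show "g x \<le> \<phi> x" using cq0[OF inb[OF x(1)] in_closure(2)[OF x(2)]] by (simp add: g_def)
  next
    fix x assume x: "x \<in> ball p R" "x \<notin> cball p (R / 2)" "x \<in> closure \<Omega>"
    then have "norm (x - p) \<ge> R / 2" by (simp add: dist_norm norm_minus_commute)
    from cqR[OF inb[OF x(1)] x(3) this] M(2)[OF x(3)] show "g x \<le> h x"
      using \<epsilon> unfolding g_def by linarith
  qed
  \<comment> \<open>A maximum argument replaces comparison: if \<open>u + c * q\<close> exceeded the
    bound, \<open>- c * q\<close> plus a constant would touch \<open>u\<close> from above at the
    maximum point, forcing \<open>- A z \<in> F\<close> against the choice of the barrier.\<close>
  have upper: "u x \<le> \<phi> p + \<epsilon> / 2 - c * q x"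
    if u: "u \<in> perron_family" and x: "x \<in> cball p R" "x \<in> closure \<Omega>" for u x
  proof -
    define K where "K = cball p R \<inter> closure \<Omega>"
    have K: "compact K" "x \<in> K" unfolding K_def using compact_closure x by auto
    have "usc_on K (\<lambda>x. u x - (- c * q x))"
      by (intro usc_on_diff_continuous continuous_intros usc_on_subset[OF famD(1)[OF u]]
          continuous_on_subset[OF contq]) (use bR in \<open>auto simp: K_def\<close>)
    from usc_attains_max[OF K(1) _ this] K(2)
    obtain z where z: "z \<in> K" "\<And>y. y \<in> K \<Longrightarrow> u y + c * q y \<le> u z + c * q z" by auto
    have zb: "z \<in> ball p r0" "z \<in> closure \<Omega>" using z(1) bR by (auto simp: K_def)
    have "u z + c * q z \<le> \<phi> p + \<epsilon> / 2"
    proof (rule ccontr)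
      assume gt: "\<not> ?thesis"
      \<comment> \<open>The maximum point is kept off the frontier by \<open>u \<le> \<phi>\<close>
        and off the outer part of the ball by the size of \<open>c\<close>, so the touching happens
        at an interior point.\<close>
      have "z \<notin> frontier \<Omega>"
      proof
        assume f: "z \<in> frontier \<Omega>"
        have "dist (\<phi> z) (\<phi> p) < \<epsilon> / 2" using d1(2)[OF f] z(1) R by (simp add: K_def dist_commute)
        then have "u z < \<phi> p + \<epsilon> / 2" using famD(4)[OF u f] unfolding dist_real_def by linarith
        then show False using cq0[OF zb] gt by simp
      qed
      then have z\<Omega>: "z \<in> \<Omega>" using closure_cases zb by blast
      have "norm (z - p) < R / 2"
      proof (rule ccontr)
        assume "\<not> ?thesis"
        then have "c * q z \<le> - M - \<bar>\<phi> p\<bar>" using cqR[OF zb] by simp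
        moreover have "u z \<le> M" using famD(3)[OF u zb(2)] M(3)[OF zb(2)] by simp
        ultimately show False using gt \<epsilon> by (simp add: abs_if split: if_splits)
      qed
      then have zR: "z \<in> ball p R" using R by (simp add: dist_norm norm_minus_commute)
      have "z \<notin> S" using zR R d3 by (auto simp: subset_iff)
      define V where "V = ball p R \<inter> \<Omega>"
      have CV: "C2_on V (\<lambda>y. - c * q y + (u z + c * q z)) (\<lambda>y. - c *\<^sub>R G y) (\<lambda>y. - c *\<^sub>R A y)"
        by (intro C2_on_affine C2_on_subset[OF C]) (use bR domain in \<open>auto simp: V_def\<close>)
      have "- c *\<^sub>R A z \<in> F"
      proof (rule subharmonicD[OF famD(2)[OF u] _ CV])
        show "z \<in> \<Omega> - S" "z \<in> V" using z\<Omega> \<open>z \<notin> S\<close> zR by (auto simp: V_def)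
        fix y assume "y \<in> V"
        then have "y \<in> K" using in_closure by (auto simp: V_def K_def)
        from z(2)[OF this] show "u y \<le> - c * q y + (u z + c * q z)" by simp
      qed simp
      then have "c *\<^sub>R (- A z) \<in> F" by simp
      then show False using cone_subequationD(5)[OF F c(1)] nA[OF zb(1)] by blast
    qed
    then show ?thesis using z(2)[OF K(2)] by linarith
  qed
  \<comment> \<open>Close to \<open>p\<close>, where \<open>q\<close> vanishes, the barrier term
    costs at most a further \<open>\<epsilon> / 2\<close> on either side.\<close>
  have "\<epsilon> / (2 * c) > 0" using \<epsilon> c by simp
  then obtain d4 where d4: "d4 > 0" "\<And>x. x \<in> ball p r0 \<Longrightarrow> dist x p < d4 \<Longrightarrow> dist (q x) (q p) < \<epsilon> / (2 * c)"
    using contq r0 unfolding continuous_on_iff by (meson centre_in_ball)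
  show ?thesis
  proof (intro bexI[OF _ lower] exI[of _ "min R d4"] conjI ballI)
    show "min R d4 > 0" using R d4 by simp
    fix x assume x: "x \<in> ball p (min R d4) \<inter> closure \<Omega>"
    then have xR: "x \<in> ball p R" and xc: "x \<in> closure \<Omega>" by auto
    have "dist (q x) (q p) < \<epsilon> / (2 * c)" using d4(2)[OF inb[OF xR]] x by (simp add: dist_commute)
    then have "- q x < \<epsilon> / (2 * c)" using qp by (simp add: dist_real_def)
    then have cq: "- (c * q x) < \<epsilon> / 2" using c by (simp add: field_simps)
    then show "\<phi> p - \<epsilon> \<le> (if x \<in> ball p R then max (h x) (g x) else h x)"
      using xR by (simp add: g_def)
    show "H x \<le> \<phi> p + \<epsilon>"
    proof (rule H_least)
      fix u assume "u \<in> perron_family"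
      from upper[OF this _ xc] xR have "u x \<le> \<phi> p + \<epsilon> / 2 - c * q x" by simp
      then show "u x \<le> \<phi> p + \<epsilon>" using cq by linarith
    qed
  qed
qed

text \<open>At a singular point the squeeze between \<open>h\<close> and \<open>w\<close> takes the
  place of the barrier, because these two continuous functions agree there; the member is
  \<open>h\<close> itself.\<close>

lemma singular_control:
  assumes s: "s \<in> S" and \<epsilon>: "\<epsilon> > 0"
  shows "\<exists>v\<in>perron_family. \<exists>r>0. \<forall>x\<in>ball s r \<inter> closure \<Omega>. h s - \<epsilon> \<le> v x \<and> H x \<le> h s + \<epsilon>"
proof -
  have sc: "s \<in> closure \<Omega>" using s S in_closure by blast
  obtain d1 where d1: "d1 > 0" "\<And>x. x \<in> closure \<Omega> \<Longrightarrow> dist x s < d1 \<Longrightarrow> dist (h x) (h s) < \<epsilon>"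
    using h_cont sc \<epsilon> unfolding continuous_on_iff by blast
  obtain d2 where d2: "d2 > 0" "\<And>x. x \<in> closure \<Omega> \<Longrightarrow> dist x s < d2 \<Longrightarrow> dist (w x) (w s) < \<epsilon>"
    using w_cont sc \<epsilon> unfolding continuous_on_iff by blast
  show ?thesis
  proof (intro bexI[OF _ h_fam] exI[of _ "min d1 d2"] conjI ballI)
    show "min d1 d2 > 0" using d1 d2 by simp
    fix x assume x: "x \<in> ball s (min d1 d2) \<inter> closure \<Omega>"
    then have "dist (h x) (h s) < \<epsilon>" "dist (w x) (w s) < \<epsilon>"
      using d1(2)[of x] d2(2)[of x] by (auto simp: dist_commute)
    then show "h s - \<epsilon> \<le> h x" "H x \<le> h s + \<epsilon>"
      using w_eq_h[OF s] H_le_w[of x] x by (auto simp: dist_real_def)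
  qed
qed

text \<open>Plays the role of the boundary of the punctured domain: the set on which the values of
  the solution are prescribed.\<close>

definition K :: "(real^'n) set" where "K = frontier \<Omega> \<union> S"

text \<open>Compactness reduces \<open>K\<close> to finitely many controlled balls, and the maximum
  of the corresponding members is one member close to \<open>H\<close> near all of \<open>K\<close>.
  One \<open>\<epsilon>\<close> is lost in \<open>v\<close> and one in \<open>H\<close>.\<close>

lemma K_control:
  assumes \<epsilon>: "\<epsilon> > 0"
  obtains v \<delta> where "v \<in> perron_family" "\<delta> > 0"
    "\<And>k x z. k \<in> K \<Longrightarrow> x \<in> closure \<Omega> \<Longrightarrow> z \<in> closure \<Omega> \<Longrightarrow> dist x k < \<delta> \<Longrightarrow> dist x z < \<delta> \<Longrightarrow>
       H z \<le> v x + 2 * \<epsilon>"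
proof -
  have "\<exists>v r a. v \<in> perron_family \<and> r > 0 \<and> (\<forall>x\<in>ball k r \<inter> closure \<Omega>. a - \<epsilon> \<le> v x \<and> H x \<le> a + \<epsilon>)"
    if "k \<in> K" for k
    using that boundary_control[OF _ \<epsilon>, of k] singular_control[OF _ \<epsilon>, of k]
    unfolding K_def by blast
  \<comment> \<open>Member, radius and prescribed value are packed into a triple so that a single
    choice function yields all three.\<close>
  then have "\<forall>k\<in>K. \<exists>t. fst t \<in> perron_family \<and> fst (snd t) > 0 \<and>
      (\<forall>x\<in>ball k (fst (snd t)) \<inter> closure \<Omega>. snd (snd t) - \<epsilon> \<le> fst t x \<and> H x \<le> snd (snd t) + \<epsilon>)"
    by (metis fst_conv snd_conv)
  from bchoice[OF this] obtain f where f: "\<forall>k\<in>K. fst (f k) \<in> perron_family \<and> fst (snd (f k)) > 0 \<and>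
      (\<forall>x\<in>ball k (fst (snd (f k))) \<inter> closure \<Omega>.
         snd (snd (f k)) - \<epsilon> \<le> fst (f k) x \<and> H x \<le> snd (snd (f k)) + \<epsilon>)"
    by blast
  define V r a where "V k = fst (f k)" and "r k = fst (snd (f k))" and "a k = snd (snd (f k))" for k
  have V: "V k \<in> perron_family" and r: "r k > 0"
    and Va: "\<And>x. x \<in> ball k (r k) \<Longrightarrow> x \<in> closure \<Omega> \<Longrightarrow> a k - \<epsilon> \<le> V k x \<and> H x \<le> a k + \<epsilon>"
    if "k \<in> K" for k
    using f that by (auto simp: V_def r_def a_def)
  have "compact K" unfolding K_def
    using domain(2) S(1) by (simp add: compact_Un compact_frontier_bounded finite_imp_compact)
  \<comment> \<open>One third of the radius for the way from the centre to \<open>k\<close>, one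
    from \<open>k\<close> to \<open>x\<close>, one from \<open>x\<close> to
    \<open>z\<close>.\<close>
  moreover have "K \<subseteq> (\<Union>k\<in>K. ball k (r k / 3))" using r by force
  ultimately obtain D where D: "D \<subseteq> K" "finite D" "K \<subseteq> (\<Union>k\<in>D. ball k (r k / 3))"
    using compactE_image[of K K "\<lambda>k. ball k (r k / 3)"] by auto
  have "\<exists>v\<in>perron_family. \<forall>k\<in>D. \<forall>x. V k x \<le> v x"
    using D(2,1)
  proof (induction D)
    case empty
    then show ?case using h_fam by blast
  next
    case (insert k D)
    then obtain v where v: "v \<in> perron_family" "\<forall>k\<in>D. \<forall>x. V k x \<le> v x" by auto
    have "V k \<in> perron_family" using V insert.prems by simp
    from fam_max[OF this v(1)] show ?case
      by (rule bexI[rotated]) (use v(2) in \<open>auto simp: le_max_iff_disj\<close>)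
  qed
  then obtain v where v: "v \<in> perron_family" "\<And>k x. k \<in> D \<Longrightarrow> V k x \<le> v x" by blast
  \<comment> \<open>The extra \<open>1\<close> keeps the minimum meaningful when \<open>D\<close> is
    empty.\<close>
  define \<delta> where "\<delta> = Min (insert 1 ((\<lambda>k. r k / 3) ` D))"
  have \<delta>: "\<delta> > 0" unfolding \<delta>_def using D r by (subst Min_gr_iff) auto
  have \<delta>r: "\<delta> \<le> r k / 3" if "k \<in> D" for k unfolding \<delta>_def using D(2) that by (intro Min_le) auto
  show thesis
  proof (rule that[OF v(1) \<delta>])
    fix k x z assume k: "k \<in> K" and x: "x \<in> closure \<Omega>" and z: "z \<in> closure \<Omega>"
      and d: "dist x k < \<delta>" "dist x z < \<delta>"
    obtain k' where k': "k' \<in> D" "dist k' k < r k' / 3" using D(3) k by auto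
    then have k'K: "k' \<in> K" using D by blast
    have "dist k' x < 2 * r k' / 3"
      using dist_triangle[of k' x k] k' d(1) \<delta>r[OF k'(1)] by (simp add: dist_commute)
    moreover from this have "dist k' z < r k'"
      using dist_triangle[of k' z x] d(2) \<delta>r[OF k'(1)] by simp
    ultimately have "x \<in> ball k' (r k')" "z \<in> ball k' (r k')" using r[OF k'K] by auto
    then have "a k' - \<epsilon> \<le> V k' x" "H z \<le> a k' + \<epsilon>" using Va[OF k'K] x z by blast+
    then show "H z \<le> v x + 2 * \<epsilon>" using v(2)[OF k'(1), of x] by linarith
  qed
qed

text \<open>Walsh's argument: translates of members of the family, lowered by a small constant and glued
  to a member that is close to \<open>H\<close> near \<open>K\<close>, belong to the family again.\<close>

lemma H_uniform:
  assumes \<epsilon>: "\<epsilon> > 0"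
  obtains \<delta> where "\<delta> > 0"
    "\<And>x z. x \<in> closure \<Omega> \<Longrightarrow> z \<in> closure \<Omega> \<Longrightarrow> dist x z < \<delta> \<Longrightarrow> H z \<le> H x + 2 * \<epsilon>"
proof -
  obtain v \<delta>1 where v: "v \<in> perron_family" and \<delta>1: "\<delta>1 > 0" and near:
    "\<And>k x z. k \<in> K \<Longrightarrow> x \<in> closure \<Omega> \<Longrightarrow> z \<in> closure \<Omega> \<Longrightarrow> dist x k < \<delta>1 \<Longrightarrow> dist x z < \<delta>1 \<Longrightarrow>
       H z \<le> v x + 2 * \<epsilon>"
    using K_control[OF \<epsilon>] by blast
  have "uniformly_continuous_on (closure \<Omega>) w"
    by (rule compact_uniformly_continuous[OF w_cont compact_closure])
  moreover have "2 * \<epsilon> > 0" using \<epsilon> by simp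
  ultimately obtain \<delta>2 where \<delta>2: "\<delta>2 > 0"
    "\<And>x z. x \<in> closure \<Omega> \<Longrightarrow> z \<in> closure \<Omega> \<Longrightarrow> dist z x < \<delta>2 \<Longrightarrow> dist (w z) (w x) < 2 * \<epsilon>"
    unfolding uniformly_continuous_on_def by blast
  \<comment> \<open>The points at distance at least \<open>\<delta>1\<close> from \<open>K\<close>.
    Elsewhere \<open>v\<close> already gives the estimate; on \<open>C\<close> a translate by
    \<open>z - x\<close> is used.\<close>
  define C where "C = closure \<Omega> - (\<Union>k\<in>K. ball k \<delta>1)"
  have C: "closed C" unfolding C_def by (intro closed_Diff open_UN) auto
  show thesis
  proof (rule that[of "min \<delta>1 \<delta>2"])
    show "min \<delta>1 \<delta>2 > 0" using \<delta>1 \<delta>2 by simp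
    fix x z assume x: "x \<in> closure \<Omega>" and z: "z \<in> closure \<Omega>" and d: "dist x z < min \<delta>1 \<delta>2"
    show "H z \<le> H x + 2 * \<epsilon>"
    proof (cases "x \<in> C")
      case False
      then obtain k where "k \<in> K" "dist x k < \<delta>1" using x by (auto simp: C_def dist_commute)
      then have "H z \<le> v x + 2 * \<epsilon>" using near x z d by simp
      then show ?thesis using fam_le_H[OF v x] by simp
    next
      case True
      define y where "y = z - x"
      have y: "norm y < \<delta>1" "norm y < \<delta>2" using d by (auto simp: y_def dist_norm norm_minus_commute)
      define N where "N = (\<Omega> - S) \<inter> {x. x + y \<in> \<Omega> - S}"
      have "{x. x + y \<in> \<Omega> - S} = (+) (- y) ` (\<Omega> - S)"
        by (force simp: image_iff intro: bexI[where x = "_ + y"])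
      then have oN: "open N" unfolding N_def
        using open_X open_translation[OF open_X, of "- y"] by (metis open_Int)
      have CN: "C \<subseteq> N"
      proof
        fix x' assume x': "x' \<in> C"
        have far: "dist k x' \<ge> \<delta>1" if "k \<in> K" for k using x' that by (force simp: C_def)
        have "x' \<in> closure \<Omega>" using x' by (simp add: C_def)
        moreover have "x' \<notin> K" using far[of x'] \<delta>1 by auto
        ultimately have 1: "x' \<in> \<Omega> - S" using closure_cases by (auto simp: K_def)
        \<comment> \<open>A step shorter than \<open>\<delta>1\<close> that left
          \<open>\<Omega>\<close> would cross the frontier too close to \<open>x'\<close>.\<close>
        have "x' + y \<in> \<Omega>"
        proof (rule ccontr)
          assume "x' + y \<notin> \<Omega>"
          then have "closed_segment x' (x' + y) \<inter> frontier \<Omega> \<noteq> {}"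
            using 1 by (intro connected_Int_frontier) auto
          then obtain k where k: "k \<in> closed_segment x' (x' + y)" "k \<in> K" by (auto simp: K_def)
          have "dist k x' \<le> dist x' (x' + y)" using dist_in_closed_segment[OF k(1)] by simp
          then show False using far[OF k(2)] y(1) by (simp add: dist_norm)
        qed
        moreover have "x' + y \<notin> S"
          using far[of "x' + y"] y(1) by (auto simp: K_def dist_norm)
        ultimately show "x' \<in> N" using 1 by (simp add: N_def)
      qed
      have N\<Omega>: "N \<subseteq> \<Omega>" and Ny: "\<And>x. x \<in> N \<Longrightarrow> x + y \<in> closure \<Omega>"
        using in_closure by (auto simp: N_def)
      show ?thesis
      proof (rule H_least)
        fix u assume u: "u \<in> perron_family"
        \<comment> \<open>The same loss \<open>2 * \<epsilon>\<close> absorbs the oscillation of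
          \<open>w\<close> under the translation, so that the obstacle is respected, and the error
          of \<open>v\<close> near \<open>K\<close>, so that the gluing condition holds outside
          \<open>C\<close>.\<close>
        define g where "g x = u (x + y) - 2 * \<epsilon>" for x
        have "subharmonic F {x. x + y \<in> \<Omega> - S} g"
          unfolding g_def by (rule subharmonic_translate[OF open_X famD(2)[OF u]])
        then have gN: "subharmonic F N g" by (rule subharmonic_subset) (simp add: N_def)
        have "(\<lambda>x. if x \<in> N then max (v x) (g x) else v x) \<in> perron_family"
        proof (rule fam_glue[OF v oN C CN])
          have "N \<inter> closure \<Omega> = N" "N \<inter> (\<Omega> - S) = N" using N\<Omega> in_closure by (auto simp: N_def)
          then show "usc_on (N \<inter> closure \<Omega>) g" "subharmonic F (N \<inter> (\<Omega> - S)) g"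
            using gN subharmonic_usc by auto
        next
          fix x' assume x': "x' \<in> N" "x' \<in> closure \<Omega>"
          have "dist (w (x' + y)) (w x') < 2 * \<epsilon>"
            using \<delta>2(2)[OF x'(2) Ny[OF x'(1)]] y(2) by (simp add: dist_norm)
          then show "g x' \<le> w x'"
            using famD(3)[OF u Ny[OF x'(1)]] by (simp add: g_def dist_real_def)
        next
          fix x' assume "x' \<in> N" "x' \<in> frontier \<Omega>"
          then show "g x' \<le> \<phi> x'" using N\<Omega> frontier_disjoint by blast
        next
          fix x' assume x': "x' \<in> N" "x' \<notin> C" "x' \<in> closure \<Omega>"
          then obtain k where "k \<in> K" "dist x' k < \<delta>1" by (auto simp: C_def dist_commute)
          then have "H (x' + y) \<le> v x' + 2 * \<epsilon>"
            using near[of k x' "x' + y"] x'(3) Ny[OF x'(1)] y(1) by (simp add: dist_norm)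
          then show "g x' \<le> v x'"
            using fam_le_H[OF u Ny[OF x'(1)]] by (simp add: g_def)
        qed
        from fam_le_H[OF this x] have "g x \<le> H x" using True CN by (auto split: if_splits)
        then show "u z \<le> H x + 2 * \<epsilon>" by (simp add: g_def y_def)
      qed
    qed
  qed
qed

section \<open>Continuity and harmonicity of the envelope\<close>

lemma H_continuous: "continuous_on (closure \<Omega>) H"
  unfolding continuous_on_iff
proof (intro ballI allI impI)
  fix x and e :: real assume x: "x \<in> closure \<Omega>" and e: "e > 0"
  have "e / 4 > 0" using e by simp
  from H_uniform[OF this] obtain \<delta> where \<delta>: "\<delta> > 0"
    "\<And>x z. x \<in> closure \<Omega> \<Longrightarrow> z \<in> closure \<Omega> \<Longrightarrow> dist x z < \<delta> \<Longrightarrow> H z \<le> H x + 2 * (e / 4)" by blast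
  show "\<exists>d>0. \<forall>x'\<in>closure \<Omega>. dist x' x < d \<longrightarrow> dist (H x') (H x) < e"
  proof (intro exI[of _ \<delta>] conjI ballI impI)
    fix x' assume "x' \<in> closure \<Omega>" "dist x' x < \<delta>"
    then have "H x \<le> H x' + 2 * (e / 4)" "H x' \<le> H x + 2 * (e / 4)"
      using \<delta>(2)[of x x'] \<delta>(2)[of x' x] x by (auto simp: dist_commute)
    then show "dist (H x') (H x) < e" using e by (simp add: dist_real_def)
  qed (rule \<delta>(1))
qed

lemma H_subharmonic: "subharmonic F (\<Omega> - S) H"
proof (rule subharmonic_Sup[OF open_X cone_subequationD(1)[OF F], where \<F> = perron_family])
  show "usc_on (\<Omega> - S) H"
    by (rule continuous_imp_usc_on, rule continuous_on_subset[OF H_continuous])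
       (use in_closure in auto)
  show "subharmonic F (\<Omega> - S) u" if "u \<in> perron_family" for u using famD(2)[OF that] .
  show "u x \<le> H x" if "u \<in> perron_family" "x \<in> \<Omega> - S" for u x using fam_le_H[OF that(1)] that(2) in_closure by blast
  show "\<exists>u\<in>perron_family. H x - e < u x" if "x \<in> \<Omega> - S" "e > 0" for x e
    using H_approx[OF _ that(2)] that(1) in_closure by blast
qed

text \<open>Continuity makes the envelope a member itself, so that a bump can be glued to
  \<open>H\<close> below.\<close>

lemma H_fam: "H \<in> perron_family"
  unfolding perron_family_def
  using continuous_imp_usc_on[OF H_continuous] H_subharmonic H_le_w
  by (auto intro: H_least famD(4))

lemma H_frontier:
  assumes "p \<in> frontier \<Omega>"
  shows "H p = \<phi> p"
proof (rule antisym)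
  show "H p \<le> \<phi> p" by (rule famD(4)[OF H_fam assms])
  have pc: "p \<in> closure \<Omega>" using assms in_closure by blast
  show "\<phi> p \<le> H p"
  proof (rule field_le_epsilon)
    fix e :: real assume "e > 0"
    from boundary_control[OF assms this] obtain v r where v: "v \<in> perron_family" "r > 0"
      "\<forall>x\<in>ball p r \<inter> closure \<Omega>. \<phi> p - e \<le> v x \<and> H x \<le> \<phi> p + e" by blast
    then have "\<phi> p - e \<le> v p" using pc by simp
    then show "\<phi> p \<le> H p + e" using fam_le_H[OF v(1) pc] by simp
  qed
qed

lemma H_S: "s \<in> S \<Longrightarrow> H s = h s"
  using H_le_w[of s] h_le_H[of s] w_eq_h[of s] S in_closure[of s] by fastforce

text \<open>The obstacle interferes only where it is attained, and there a lower test function for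
  \<open>H\<close> is also one for the supersolution \<open>w\<close>. Elsewhere there is room for a
  Perron bump, which would give a member larger than \<open>H\<close> at \<open>y\<close>.\<close>

lemma H_dual_subharmonic: "subharmonic (dual_subeq F) (\<Omega> - S) (\<lambda>x. - H x)"
proof (rule dual_subharmonicI[OF open_X])
  show "continuous_on (\<Omega> - S) H"
    by (rule continuous_on_subset[OF H_continuous]) (use in_closure in auto)
  fix y U \<psi> G A
  assume y: "y \<in> U" and UX: "U \<subseteq> \<Omega> - S" and C: "C2_on U \<psi> G A"
    and le: "\<And>x. x \<in> U \<Longrightarrow> \<psi> x \<le> H x" and eq: "\<psi> y = H y"
  have Uc: "x \<in> closure \<Omega>" if "x \<in> U" for x using that UX in_closure by blast
  show "A y \<notin> IntF F"
  proof (cases "H y = w y")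
    case True
    show ?thesis
    proof (rule dual_subharmonicD[OF w_super _ C y])
      show "y \<in> \<Omega> - S" using y UX by blast
      show "\<psi> x \<le> w x" if "x \<in> U" for x using le[OF that] H_le_w[OF Uc[OF that]] by simp
    qed (simp add: eq True)
  next
    case False
    then have lt: "\<psi> y < w y" using H_le_w[OF Uc[OF y]] eq by simp
    show ?thesis
    proof
      assume "A y \<in> IntF F"
      then obtain e where e: "e > 0" "\<And>B. B \<in> Sym \<Longrightarrow> dist B (A y) < e \<Longrightarrow> B \<in> F"
        using IntF_dest by blast
      then have e2: "e / 2 > 0" by simp
      obtain \<eta> where \<eta>: "\<eta> > 0" "norm ((2 * \<eta>) *\<^sub>R (mat 1 :: real^'n^'n)) \<le> e / 2"
        using small_multiple[OF e2, of "mat 1 :: real^'n^'n"] by blast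
      obtain d1 where d1: "d1 > 0" "\<And>x. x \<in> U \<Longrightarrow> dist x y < d1 \<Longrightarrow> dist (A x) (A y) < e / 2"
        using C2_onD(2)[OF C] y e2 unfolding continuous_on_iff by blast
      \<comment> \<open>Half the gap at \<open>y\<close>: by continuity
        \<open>\<psi> + \<delta>0\<close> stays below \<open>w\<close> near
        \<open>y\<close>.\<close>
      define \<delta>0 where "\<delta>0 = (w y - \<psi> y) / 2"
      have \<delta>0: "\<delta>0 > 0" using lt by (simp add: \<delta>0_def)
      have "continuous_on U (\<lambda>x. w x - \<psi> x)"
        by (intro continuous_intros C2_on_continuous[OF C] continuous_on_subset[OF w_cont]) (use Uc in blast)
      then obtain d2 where d2: "d2 > 0"
        "\<And>x. x \<in> U \<Longrightarrow> dist x y < d2 \<Longrightarrow> dist (w x - \<psi> x) (w y - \<psi> y) < \<delta>0"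
        using y \<delta>0 unfolding continuous_on_iff by blast
      obtain d3 where d3: "d3 > 0" "ball y d3 \<subseteq> U" using C2_onD(1)[OF C] y openE by blast
      define R where "R = min d1 (min d2 d3)"
      have R: "R > 0" and RU: "ball y R \<subseteq> U" using d1 d2 d3 by (auto simp: R_def subset_iff)
      \<comment> \<open>The first bound respects the obstacle; the second lets the quadratic loss
        outside the half ball cancel the lift, so that the bump falls back to at most
        \<open>\<psi>\<close>, hence \<open>H\<close>, there.\<close>
      define \<delta> where "\<delta> = min \<delta>0 (\<eta> * (R / 2)\<^sup>2)"
      have \<delta>: "\<delta> > 0" "\<delta> \<le> \<delta>0" "\<delta> \<le> \<eta> * (R / 2)\<^sup>2" using \<delta>0 \<eta> R by (auto simp: \<delta>_def)
      define g where "g x = \<psi> x + (- \<eta>) * (norm (x - y))\<^sup>2 + \<delta>" for x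
      define B where "B x = A x + (2 * (- \<eta>)) *\<^sub>R mat 1" for x
      have Cg: "C2_on (ball y R) g (\<lambda>x. G x + (2 * (- \<eta>)) *\<^sub>R (x - y)) B"
        unfolding g_def B_def by (rule C2_on_add_sqdist[OF C2_on_subset[OF C _ RU]]) simp
      have BF: "B x \<in> F" if x: "x \<in> ball y R" for x
      proof (rule e(2)[OF C2_on_Sym[OF Cg x]])
        have "dist (A x) (A y) < e / 2" using d1(2)[OF subsetD[OF RU x]] x by (simp add: R_def dist_commute)
        moreover have "dist (B x) (A y) \<le> norm (A x - A y) + norm ((2 * \<eta>) *\<^sub>R (mat 1 :: real^'n^'n))"
          unfolding dist_norm using norm_triangle_ineq4[of "A x - A y" "(2 * \<eta>) *\<^sub>R (mat 1 :: real^'n^'n)"]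
          by (simp add: B_def algebra_simps)
        ultimately show "dist (B x) (A y) < e" using \<eta>(2) unfolding dist_norm by linarith
      qed
      have g_le: "g x \<le> \<psi> x + \<delta>" for x using \<eta> by (simp add: g_def)
      have "(\<lambda>x. if x \<in> ball y R then max (H x) (g x) else H x) \<in> perron_family"
      proof (rule fam_glue[OF H_fam])
        show "open (ball y R)" "closed (cball y (R / 2))" "cball y (R / 2) \<subseteq> ball y R" using R by auto
        show "usc_on (ball y R \<inter> closure \<Omega>) g"
          by (intro continuous_imp_usc_on continuous_on_subset[OF C2_on_continuous[OF Cg]]) simp
        show "subharmonic F (ball y R \<inter> (\<Omega> - S)) g"
          by (rule subharmonic_subset[OF C2_subharmonic[OF F Cg BF]]) auto
      next
        fix x assume x: "x \<in> ball y R" "x \<in> closure \<Omega>"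
        have "dist (w x - \<psi> x) (w y - \<psi> y) < \<delta>0"
          using d2(2)[OF subsetD[OF RU x(1)]] x(1) by (simp add: R_def dist_commute)
        then have "\<psi> x + \<delta>0 \<le> w x" unfolding dist_real_def abs_less_iff \<delta>0_def by (simp add: field_simps)
        then show "g x \<le> w x" using g_le[of x] \<delta>(2) by linarith
      next
        fix x assume "x \<in> ball y R" "x \<in> frontier \<Omega>"
        then show "g x \<le> \<phi> x" using RU UX frontier_disjoint by blast
      next
        fix x assume x: "x \<in> ball y R" "x \<notin> cball y (R / 2)" "x \<in> closure \<Omega>"
        then have "(R / 2)\<^sup>2 \<le> (norm (x - y))\<^sup>2"
          using R by (intro power_mono) (auto simp: dist_norm norm_minus_commute)
        then have "\<eta> * (R / 2)\<^sup>2 \<le> \<eta> * (norm (x - y))\<^sup>2" using \<eta> by simp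
        then have "g x \<le> \<psi> x" using \<delta>(3) by (simp add: g_def)
        then show "g x \<le> H x" using le[of x] x RU by fastforce
      qed
      from fam_le_H[OF this Uc[OF y]] have "g y \<le> H y" using R by simp
      then show False using \<delta>(1) eq by (simp add: g_def)
    qed
  qed
qed

lemma H_harmonic: "harmonic F (\<Omega> - S) H"
  unfolding harmonic_def
  using H_subharmonic H_dual_subharmonic continuous_on_subset[OF H_continuous, of "\<Omega> - S"] in_closure
  by blast

end

section \<open>Prescribed singularities\<close>

text \<open>Near \<open>p\<close> the limit of the quotient bounds \<open>h - h p\<close> by twice
  \<open>l - l p\<close>. Away from \<open>p\<close> the strict minimum at \<open>p\<close> and
  compactness give a positive gap \<open>m\<close>, and a large factor lifts the right-hand side
  above \<open>M\<close>.\<close>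

lemma dominating_multiple:
  fixes \<Omega> :: "(real^'n) set" and l :: "real^'n \<Rightarrow> real"
  assumes \<Omega>: "open \<Omega>" "bounded \<Omega>" and p: "p \<in> \<Omega>"
    and l: "continuous_on (closure \<Omega>) l" "\<And>y. y \<in> closure \<Omega> \<Longrightarrow> y \<noteq> p \<Longrightarrow> l p < l y"
    and lim: "((\<lambda>y. (h y - h p) / (l y - l p)) \<longlongrightarrow> 1) (at p)"
    and M: "\<And>y. y \<in> closure \<Omega> \<Longrightarrow> h y \<le> M" "\<And>y. y \<in> frontier \<Omega> \<Longrightarrow> \<phi> y \<le> M"
  obtains c where "c > 1" "\<And>y. y \<in> closure \<Omega> \<Longrightarrow> h y \<le> h p + c * (l y - l p)"
    "\<And>y. y \<in> frontier \<Omega> \<Longrightarrow> \<phi> y \<le> h p + c * (l y - l p)"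
proof -
  have "\<forall>\<^sub>F y in at p. (h y - h p) / (l y - l p) < 2"
    using order_tendstoD(2)[OF lim, of 2] by simp
  then obtain r0 where r0: "r0 > 0"
    "\<And>y. y \<noteq> p \<Longrightarrow> dist y p < r0 \<Longrightarrow> (h y - h p) / (l y - l p) < 2"
    unfolding eventually_at by blast
  obtain r1 where r1: "r1 > 0" "ball p r1 \<subseteq> \<Omega>" using \<Omega>(1) p openE by blast
  define r where "r = min r0 r1"
  have r: "r > 0" "ball p r \<subseteq> \<Omega>" using r0 r1 by (auto simp: r_def subset_iff)
  have "\<exists>m>0. \<forall>y\<in>closure \<Omega> - ball p r. m \<le> l y - l p"
  proof (cases "closure \<Omega> - ball p r = {}")
    case True
    then show ?thesis by (intro exI[of _ 1]) auto
  next
    case False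
    have "compact (closure \<Omega> - ball p r)" using \<Omega>(2) by (intro compact_diff) auto
    from continuous_attains_inf[OF this False continuous_on_subset[OF l(1) Diff_subset]]
    obtain z where z: "z \<in> closure \<Omega> - ball p r" "\<And>y. y \<in> closure \<Omega> - ball p r \<Longrightarrow> l z \<le> l y" by auto
    have "z \<noteq> p" using z(1) r by auto
    then have "l p < l z" using l(2)[of z] z(1) by blast
    then show ?thesis using z(2) by (intro exI[of _ "l z - l p"]) auto
  qed
  then obtain m where m: "m > 0" "\<And>y. y \<in> closure \<Omega> \<Longrightarrow> y \<notin> ball p r \<Longrightarrow> m \<le> l y - l p" by blast
  define c where "c = max 2 ((M - h p) / m)"
  have c: "c \<ge> 2" "M - h p \<le> c * m" using m by (auto simp: c_def field_simps max_def)
  have far: "M \<le> h p + c * (l y - l p)" if "y \<in> closure \<Omega>" "y \<notin> ball p r" for y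
  proof -
    have "c * m \<le> c * (l y - l p)" using m(2)[OF that] c by (intro mult_left_mono) auto
    then show ?thesis using c(2) by linarith
  qed
  show thesis
  proof (rule that)
    show "c > 1" using c by simp
    fix y assume y: "y \<in> closure \<Omega>"
    show "h y \<le> h p + c * (l y - l p)"
    proof (cases "y \<in> ball p r \<and> y \<noteq> p")
      case True
      have pos: "l y - l p > 0" using l(2)[OF y] True by simp
      have "(h y - h p) / (l y - l p) < 2" using r0(2)[of y] True by (simp add: r_def dist_commute)
      then have "h y - h p < 2 * (l y - l p)" using pos by (simp add: field_simps)
      also have "\<dots> \<le> c * (l y - l p)" using c pos by (intro mult_right_mono) auto
      finally show ?thesis by simp
    next
      case False
      show ?thesis
      proof (cases "y = p")
        case False
        with \<open>\<not> (y \<in> ball p r \<and> y \<noteq> p)\<close> show ?thesis using order_trans[OF M(1)[OF y] far[OF y]] by blast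
      qed simp
    qed
  next
    fix y assume y: "y \<in> frontier \<Omega>"
    then have "y \<in> closure \<Omega>" "y \<notin> ball p r"
      using r(2) \<Omega>(1) by (auto simp: frontier_def interior_open)
    from order_trans[OF M(2)[OF y] far[OF this]] show "\<phi> y \<le> h p + c * (l y - l p)" .
  qed
qed

theorem theorem8p1:
  fixes F :: "(real^'n^'n) set" and \<Omega> :: "(real^'n) set"
    and \<phi> :: "real^'n \<Rightarrow> real" and k :: nat and x :: "nat \<Rightarrow> real^'n"
    and hs :: "nat \<Rightarrow> real^'n \<Rightarrow> real" and h :: "real^'n \<Rightarrow> real"
  assumes F: "cone_subequation F"
    and negP: "\<forall>e. norm e = 1 \<longrightarrow> - projline e \<notin> F"
    and dom: "open \<Omega>" "connected \<Omega>" "bounded \<Omega>" "\<Omega> \<noteq> {}"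
    and phi: "continuous_on (frontier \<Omega>) \<phi>"
    and pts: "\<forall>j<k. x j \<in> \<Omega>" "inj_on x {..<k}"
    and hj: "\<forall>j<k. continuous_on (closure \<Omega>) (hs j) \<and> harmonic F (\<Omega> - {x j}) (hs j)
                     \<and> downward_singularity F (hs j) (x j)"
    and i: "smooth_boundary \<Omega>" "strictly_F_convex_boundary F \<Omega>"
    and ii: "\<forall>j<k. \<forall>y\<in>closure \<Omega> - {x j}. hs j y > hs j (x j)"
    and iii: "continuous_on (closure \<Omega>) h" "subharmonic F (\<Omega> - x ` {..<k}) h"
      "\<forall>j<k. ((\<lambda>y. (h y - h (x j)) / (hs j y - hs j (x j))) \<longlongrightarrow> 1) (at (x j))"
      "\<forall>y\<in>frontier \<Omega>. h y \<le> \<phi> y"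
  shows "\<exists>H. continuous_on (closure \<Omega>) H \<and> harmonic F (\<Omega> - x ` {..<k}) H \<and>
     (\<forall>y\<in>frontier \<Omega>. H y = \<phi> y) \<and> (\<forall>j<k. H (x j) = h (x j)) \<and>
     (\<exists>c>1. \<forall>\<epsilon>>0. \<forall>j<k. \<forall>\<^sub>F y in at (x j).
        1 - \<epsilon> \<le> (H y - h (x j)) / (hs j y - hs j (x j)) \<and>
        (H y - h (x j)) / (hs j y - hs j (x j)) \<le> c)"
proof -
  define X where "X = \<Omega> - x ` {..<k}"
  have X: "open X" unfolding X_def using dom(1) by (intro open_Diff finite_imp_closed) auto
  have X\<Omega>: "X \<subseteq> closure \<Omega>" using closure_subset by (auto simp: X_def)
  have \<Omega>c: "y \<in> closure \<Omega>" if "y \<in> \<Omega>" for y using that closure_subset by blast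
  have fc: "y \<in> closure \<Omega>" if "y \<in> frontier \<Omega>" for y using that by (simp add: frontier_def)
  have cpt: "compact (closure \<Omega>)" "compact (frontier \<Omega>)"
    using dom(3) by (auto intro: compact_frontier_bounded)
  have "bounded (h ` closure \<Omega>)"
    using compact_continuous_image[OF iii(1) cpt(1)] by (rule compact_imp_bounded)
  then obtain a where a: "\<And>y. y \<in> closure \<Omega> \<Longrightarrow> norm (h y) \<le> a"
    unfolding bounded_iff by blast
  have "bounded (\<phi> ` frontier \<Omega>)"
    using compact_continuous_image[OF phi cpt(2)] by (rule compact_imp_bounded)
  then obtain b where b: "\<And>y. y \<in> frontier \<Omega> \<Longrightarrow> norm (\<phi> y) \<le> b"
    unfolding bounded_iff by blast
  have M: "h y \<le> max a b" if "y \<in> closure \<Omega>" for y using a[OF that] by (simp add: abs_le_iff le_max_iff_disj)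
  have M': "\<phi> y \<le> max a b" if "y \<in> frontier \<Omega>" for y using b[OF that] by (simp add: abs_le_iff le_max_iff_disj)
  have gap: "hs j y > hs j (x j)" if "j < k" "y \<in> closure \<Omega>" "y \<noteq> x j" for j y using ii that by blast
  have gap0: "hs j y - hs j (x j) \<ge> 0" if "j < k" "y \<in> closure \<Omega>" for j y
    using gap[OF that] by (cases "y = x j") auto
  \<comment> \<open>Induction on the number \<open>m\<close> of singularities already built into the
    obstacle, starting from a constant above \<open>h\<close> and \<open>\<phi>\<close>. Each step
    takes the minimum with a dominating multiple of \<open>hs m\<close>, and \<open>c\<close> bounds
    the factors so far; it becomes the constant of the upper estimate.\<close>
  have "\<exists>w c. c > 1 \<and> continuous_on (closure \<Omega>) w \<and> subharmonic (dual_subeq F) X (\<lambda>y. - w y) \<and>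
      (\<forall>y\<in>closure \<Omega>. h y \<le> w y) \<and> (\<forall>y\<in>frontier \<Omega>. \<phi> y \<le> w y) \<and>
      (\<forall>j<m. \<forall>y\<in>closure \<Omega>. w y \<le> h (x j) + c * (hs j y - hs j (x j)))" if "m \<le> k" for m
    using that
  proof (induction m)
    case 0
    show ?case
      using dual_subharmonic_const[OF F negP X, of "max a b"] M M'
      by (intro exI[of _ "\<lambda>_. max a b"] exI[of _ 2]) auto
  next
    case (Suc m)
    then obtain w c where c: "c > 1" and w: "continuous_on (closure \<Omega>) w"
      "subharmonic (dual_subeq F) X (\<lambda>y. - w y)"
      "\<And>y. y \<in> closure \<Omega> \<Longrightarrow> h y \<le> w y" "\<And>y. y \<in> frontier \<Omega> \<Longrightarrow> \<phi> y \<le> w y"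
      "\<And>j y. j < m \<Longrightarrow> y \<in> closure \<Omega> \<Longrightarrow> w y \<le> h (x j) + c * (hs j y - hs j (x j))"
      using Suc_leD[OF Suc.prems] by auto
    have mk: "m < k" using Suc.prems by simp
    have hm: "continuous_on (closure \<Omega>) (hs m)" "harmonic F (\<Omega> - {x m}) (hs m)" using hj mk by auto
    obtain c' where c': "c' > 1" and dh: "\<And>y. y \<in> closure \<Omega> \<Longrightarrow> h y \<le> h (x m) + c' * (hs m y - hs m (x m))"
      and dphi: "\<And>y. y \<in> frontier \<Omega> \<Longrightarrow> \<phi> y \<le> h (x m) + c' * (hs m y - hs m (x m))"
      by (rule dominating_multiple[OF dom(1,3) pts(1)[rule_format, OF mk] hm(1) _
            iii(3)[rule_format, OF mk], of "max a b" \<phi>]) (use gap[OF mk] M M' in blast)+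
    define v where "v y = h (x m) + c' * (hs m y - hs m (x m))" for y
    have vc: "continuous_on (closure \<Omega>) v" unfolding v_def by (intro continuous_intros hm(1))
    have "subharmonic (dual_subeq F) X (\<lambda>y. - hs m y)"
      by (rule subharmonic_subset[of _ "\<Omega> - {x m}"]) (use hm(2) mk in \<open>auto simp: harmonic_def X_def\<close>)
    then have vs: "subharmonic (dual_subeq F) X (\<lambda>y. - v y)" unfolding v_def
      by (intro dual_subharmonic_affine[OF F X] continuous_on_subset[OF hm(1) X\<Omega>]) (use c' in auto)
    \<comment> \<open>A minimum of supersolutions is one: under negation it becomes a maximum of
      dual subharmonic functions.\<close>
    have ms: "subharmonic (dual_subeq F) X (\<lambda>y. - min (w y) (v y))"
      using subharmonic_max[OF X w(2) vs] by (simp add: minus_min_eq_max)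
    \<comment> \<open>Raising the factor is harmless because \<open>hs j\<close> is minimal at
      \<open>x j\<close>; earlier bounds survive the passage to \<open>max c c'\<close>.\<close>
    have mono: "c1 * (hs j y - hs j (x j)) \<le> max c c' * (hs j y - hs j (x j))"
      if "c1 = c \<or> c1 = c'" "j < k" "y \<in> closure \<Omega>" for c1 j y
      using that by (intro mult_right_mono gap0) auto
    have "min (w y) (v y) \<le> h (x j) + max c c' * (hs j y - hs j (x j))"
      if j: "j < Suc m" and y: "y \<in> closure \<Omega>" for j y
    proof (cases "j = m")
      case True
      then show ?thesis using mono[of c' m y] mk y by (simp add: v_def min_le_iff_disj)
    next
      case False
      then have "j < m" using j by simp
      then show ?thesis using w(5)[of j y] mono[of c j y] mk y by (simp add: min_le_iff_disj)
    qed
    then show ?case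
      using c ms vc w dh dphi
      by (intro exI[of _ "\<lambda>y. min (w y) (v y)"] exI[of _ "max c c'"])
         (auto intro!: continuous_intros simp: v_def)
  qed
  from this[of k] obtain w c where c: "c > 1" and w: "continuous_on (closure \<Omega>) w"
    "subharmonic (dual_subeq F) X (\<lambda>y. - w y)"
    "\<And>y. y \<in> closure \<Omega> \<Longrightarrow> h y \<le> w y" "\<And>y. y \<in> frontier \<Omega> \<Longrightarrow> \<phi> y \<le> w y"
    "\<And>j y. j < k \<Longrightarrow> y \<in> closure \<Omega> \<Longrightarrow> w y \<le> h (x j) + c * (hs j y - hs j (x j))"
    by auto
  interpret obstacle_problem F \<Omega> "x ` {..<k}" \<phi> h w
  proof
    \<comment> \<open>At \<open>x j\<close> the difference of \<open>hs j\<close> vanishes, so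
      \<open>w\<close> is at most \<open>h\<close> there, while \<open>h \<le> w\<close> on the
      whole closure.\<close>
    show "w y = h y" if "y \<in> x ` {..<k}" for y
      using that w(3)[of y] w(5)[of _ y] pts(1) \<Omega>c by fastforce
  qed (use F negP dom i pts phi iii w in \<open>auto simp: X_def\<close>)
  \<comment> \<open>The lower estimate is inherited from the limit for \<open>h\<close> through
    \<open>h \<le> H\<close>, the upper one from the obstacle through
    \<open>H \<le> w\<close>.\<close>
  have ratio: "\<forall>\<^sub>F y in at (x j). 1 - \<epsilon> \<le> (H y - h (x j)) / (hs j y - hs j (x j)) \<and>
        (H y - h (x j)) / (hs j y - hs j (x j)) \<le> c" if \<epsilon>: "\<epsilon> > 0" and j: "j < k" for \<epsilon> j
  proof -
    have "\<forall>\<^sub>F y in at (x j). 1 - \<epsilon> < (h y - h (x j)) / (hs j y - hs j (x j))"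
      using iii(3) j \<epsilon> by (intro order_tendstoD(1)[where y = 1]) auto
    moreover have "\<forall>\<^sub>F y in at (x j). y \<in> \<Omega>"
      using dom(1) pts(1) j by (intro eventually_at_in_open') auto
    moreover have "\<forall>\<^sub>F y in at (x j). y \<noteq> x j" by (simp add: eventually_at_filter)
    ultimately show ?thesis
    proof eventually_elim
      case (elim y)
      have y: "y \<in> closure \<Omega>" using elim \<Omega>c by blast
      have pos: "hs j y - hs j (x j) > 0" using gap[OF j y] elim by simp
      have "(h y - h (x j)) / (hs j y - hs j (x j)) \<le> (H y - h (x j)) / (hs j y - hs j (x j))"
        using h_le_H[OF y] pos by (intro divide_right_mono) auto
      moreover have "(H y - h (x j)) / (hs j y - hs j (x j)) \<le> c"
        using H_le_w[OF y] w(5)[OF j y] pos by (simp add: pos_divide_le_eq)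
      ultimately show ?case using elim(1) by (intro conjI) linarith+
    qed
  qed
  show ?thesis
    using H_continuous H_harmonic H_frontier H_S ratio c by (intro exI[of _ H]) blast
qed

end
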